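(* Let $A\in L^1_{\mathrm{loc}}(\mathbb{R})^{d\times d}$ be such that the propagator of $y'=A(x)y$ is exponentially bounded on $\mathbb{R}$ and such that $y'=A(x)y$ has an exponential dichotomy $Q$ on $\mathbb{R}$. Assume $Q=Q_1+Q_2$, where $Q_1,Q_2$ are projections uniformly conjugated by $\Phi$ on $\mathbb{R}$ with $$\varkappa'(Q_1)\le\varkappa(Q_1)<\varkappa'(Q_2)\le\varkappa(Q_2)<0<\varkappa'(I_d-Q)\le\varkappa(I_d-Q).$$ Let $R\in L^1_{\mathrm{loc}}(\mathbb{R})^{d\times d}$ satisfy $\|R\|_{\mathbb{C}^{d\times d}}\in L^1(\mathbb{R}_+;e^{\beta x}dx)$ for some $$\beta>\max_{j=1,2}\{\lambda_+(Q_j)-\varkappa_+'(Q_j)\}.$$ Then the perturbed equation has generalized matrix-valued Jost solutions $Y_+^{(1)},Y_+^{(2)}$ associated with $Q_1,Q_2$; that is, there exist $d\times d$ matrix-valued solutions $Y_+^{(j)}$, $j=1,2$, of $Y'(x)=(A(x)+R(x))Y(x)$ on $\mathbb{R}_+$ with $$\limsup_{x\to\infty}\frac{\log\|Y_+^{(j)}(x)-\Phi(x)Q_j\|_{\mathbb{C}^{d\times d}}}{x}<\varkappa_+'(Q_j)\quad\text{and}\quad Y_+^{(j)}(0)=Y_+^{(j)}(0)Q_j,\qquad j=1,2.$$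
   Context: $\mathbb{R}_+=[0,\infty)$, $\log0=-\infty$. $\Phi'=A\Phi$ a.e., $\Phi(0)=I_d$. The propagator is exponentially bounded on $\mathbb{R}$ if $\sup_{|x-x'|\le1}\|\Phi(x)\Phi(x')^{-1}\|<\infty$. A projection $Q$ in $\mathbb{C}^d$ is an exponential dichotomy on $\mathbb{R}$ if there are constants $\varkappa,\varkappa'>0$, $C,C'\ge1$ with $\|\Phi(x)Q\Phi(x')^{-1}\|\le Ce^{-\varkappa(x-x')}$ for $x\ge x'$ and $\|\Phi(x)(I_d-Q)\Phi(x')^{-1}\|\le C'e^{\varkappa'(x-x')}$ for $x\le x'$. A projection $P$ is uniformly conjugated by $\Phi$ on $\mathbb{R}$ if $\sup_{x\in\mathbb{R}}\|\Phi(x)P\Phi(x)^{-1}\|<\infty$. For such $P$, the Bohl exponent $\varkappa(P)$ (resp. $\varkappa'(P)$) on $\mathbb{R}$ is the infimum (resp. supremum) of all $\varkappa\in\mathbb{R}$ for which there is a constant $C(\varkappa)$ with $\|\Phi(x)P\Phi(x')^{-1}\|\le C(\varkappa)e^{\varkappa(x-x')}$ for all $x\ge x'$ (resp. $x\le x'$), $x,x'\in\mathbb{R}$; $\varkappa_+(P)$, $\varkappa_+'(P)$ are defined in the same way with $x,x'$ restricted to $\mathbb{R}_+$. The upper Lyapunov exponent on $\mathbb{R}_+$ is $\lambda_+(P)=\limsup_{x\to\infty}x^{-1}\log\|\Phi(x)P\|$. *)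

theory Defs
  imports "HOL-Analysis.Analysis"
begin

text \<open>
  Matrices carry the library norm of \<^typ>\<open>complex^'d^'d\<close>, which is the Frobenius norm. All notions
  below are invariant under passing to an equivalent norm.
\<close>

type_synonym 'd cmat = "complex^'d^'d"

definition L1_loc :: "(real \<Rightarrow> 'a::euclidean_space) \<Rightarrow> bool" where
  "L1_loc f \<longleftrightarrow> (\<forall>a b. f absolutely_integrable_on {a..b})"

text \<open>
  \<open>D division_of \<Union>D\<close> says that \<open>D\<close> is a finite family of nonempty compact intervals with pairwise
  disjoint interiors; the interval \<open>K\<close> is \<open>{Inf K..Sup K}\<close>.
\<close>

definition absolutely_continuous_interval ::
    "(real \<Rightarrow> 'a::real_normed_vector) \<Rightarrow> real \<Rightarrow> real \<Rightarrow> bool" where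
  "absolutely_continuous_interval f a b \<longleftrightarrow>
     (\<forall>\<epsilon>>0. \<exists>\<delta>>0. \<forall>D. D division_of \<Union>D \<and> \<Union>D \<subseteq> {a..b} \<and> (\<Sum>K\<in>D. Sup K - Inf K) < \<delta>
        \<longrightarrow> (\<Sum>K\<in>D. norm (f (Sup K) - f (Inf K))) < \<epsilon>)"

definition locally_absolutely_continuous_on ::
    "real set \<Rightarrow> (real \<Rightarrow> 'a::real_normed_vector) \<Rightarrow> bool" where
  "locally_absolutely_continuous_on I f \<longleftrightarrow>
     (\<forall>a b. {a..b} \<subseteq> I \<longrightarrow> absolutely_continuous_interval f a b)"

text \<open>Caratheodory solutions of \<open>Y' = A Y\<close>, understood almost everywhere on the interval \<open>I\<close>.\<close>

definition matrix_solution_on ::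
    "real set \<Rightarrow> (real \<Rightarrow> ('d::finite) cmat) \<Rightarrow> (real \<Rightarrow> 'd cmat) \<Rightarrow> bool" where
  "matrix_solution_on I A Y \<longleftrightarrow>
     locally_absolutely_continuous_on I Y \<and>
     (AE x in lebesgue. x \<in> I \<longrightarrow> (Y has_vector_derivative A x ** Y x) (at x within I))"

definition propagator :: "(real \<Rightarrow> ('d::finite) cmat) \<Rightarrow> (real \<Rightarrow> 'd cmat) \<Rightarrow> bool" where
  "propagator A \<Phi> \<longleftrightarrow> matrix_solution_on UNIV A \<Phi> \<and> \<Phi> 0 = mat 1"

definition projection :: "('d::finite) cmat \<Rightarrow> bool" where
  "projection P \<longleftrightarrow> P ** P = P"

definition exponentially_bounded :: "(real \<Rightarrow> ('d::finite) cmat) \<Rightarrow> bool" where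
  "exponentially_bounded \<Phi> \<longleftrightarrow>
     bdd_above {norm (\<Phi> x ** matrix_inv (\<Phi> x')) |x x'. \<bar>x - x'\<bar> \<le> 1}"

definition exponential_dichotomy :: "(real \<Rightarrow> ('d::finite) cmat) \<Rightarrow> 'd cmat \<Rightarrow> bool" where
  "exponential_dichotomy \<Phi> Q \<longleftrightarrow> projection Q \<and>
     (\<exists>\<kappa> \<kappa>' C C'. \<kappa> > 0 \<and> \<kappa>' > 0 \<and> C \<ge> 1 \<and> C' \<ge> 1 \<and>
        (\<forall>x x'. x \<ge> x' \<longrightarrow>
           norm (\<Phi> x ** Q ** matrix_inv (\<Phi> x')) \<le> C * exp (- \<kappa> * (x - x'))) \<and>
        (\<forall>x x'. x \<le> x' \<longrightarrow>
           norm (\<Phi> x ** (mat 1 - Q) ** matrix_inv (\<Phi> x')) \<le> C' * exp (\<kappa>' * (x - x'))))"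

definition uniformly_conjugated :: "(real \<Rightarrow> ('d::finite) cmat) \<Rightarrow> 'd cmat \<Rightarrow> bool" where
  "uniformly_conjugated \<Phi> P \<longleftrightarrow> bdd_above (range (\<lambda>x. norm (\<Phi> x ** P ** matrix_inv (\<Phi> x))))"

text \<open>
  Bohl exponents \<open>\<kappa>(P)\<close>, \<open>\<kappa>'(P)\<close> on a set \<open>I\<close>, as extended reals: infimum and supremum are taken
  in \<^typ>\<open>ereal\<close>, so that \<open>\<kappa>(0) = -\<infinity>\<close> and \<open>\<kappa>'(0) = \<infinity>\<close>.
\<close>

definition bohl_upper :: "real set \<Rightarrow> (real \<Rightarrow> ('d::finite) cmat) \<Rightarrow> 'd cmat \<Rightarrow> ereal" where
  "bohl_upper I \<Phi> P = Inf (ereal ` {\<kappa>. \<exists>C. \<forall>x\<in>I. \<forall>x'\<in>I. x \<ge> x' \<longrightarrow>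
     norm (\<Phi> x ** P ** matrix_inv (\<Phi> x')) \<le> C * exp (\<kappa> * (x - x'))})"

definition bohl_lower :: "real set \<Rightarrow> (real \<Rightarrow> ('d::finite) cmat) \<Rightarrow> 'd cmat \<Rightarrow> ereal" where
  "bohl_lower I \<Phi> P = Sup (ereal ` {\<kappa>. \<exists>C. \<forall>x\<in>I. \<forall>x'\<in>I. x \<le> x' \<longrightarrow>
     norm (\<Phi> x ** P ** matrix_inv (\<Phi> x')) \<le> C * exp (\<kappa> * (x - x'))})"

text \<open>The logarithm with \<open>log 0 = -\<infinity>\<close> (the library has \<open>ln 0 = 0\<close>); used for \<open>t \<ge> 0\<close> only.\<close>

definition elog :: "real \<Rightarrow> ereal" where
  "elog t = (if t = 0 then -\<infinity> else ereal (ln t))"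

definition growth_rate :: "(real \<Rightarrow> ('d::finite) cmat) \<Rightarrow> ereal" where
  "growth_rate F = Limsup at_top (\<lambda>x. elog (norm (F x)) / ereal x)"

definition upper_lyapunov :: "(real \<Rightarrow> ('d::finite) cmat) \<Rightarrow> 'd cmat \<Rightarrow> ereal" where
  "upper_lyapunov \<Phi> P = growth_rate (\<lambda>x. \<Phi> x ** P)"

text \<open>
  Generalized matrix-valued Jost solution of \<open>Y' = (A + R) Y\<close> on the half-line associated with \<open>P\<close>,
  where \<open>\<Phi>\<close> is the propagator of \<open>y' = A y\<close>.
\<close>

definition generalized_jost_solution ::
    "(real \<Rightarrow> ('d::finite) cmat) \<Rightarrow> (real \<Rightarrow> 'd cmat) \<Rightarrow> (real \<Rightarrow> 'd cmat) \<Rightarrow> 'd cmat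
      \<Rightarrow> (real \<Rightarrow> 'd cmat) \<Rightarrow> bool" where
  "generalized_jost_solution A R \<Phi> P Y \<longleftrightarrow>
     matrix_solution_on {0..} (\<lambda>x. A x + R x) Y \<and>
     growth_rate (\<lambda>x. Y x - \<Phi> x ** P) < bohl_lower {0..} \<Phi> P \<and>
     Y 0 = Y 0 ** P"

end

theory Submission
  imports Defs
begin

text \<open>
  For each \<open>j\<close> one splits \<open>I = P\<^sub>0 + P\<^sub>1\<close> (\<open>P\<^sub>0 = 0\<close> for \<open>j = 1\<close>, \<open>P\<^sub>0 = Q\<^sub>1\<close> for \<open>j = 2\<close>) and picks a rate \<open>\<gamma>\<close>
  below \<open>\<kappa>'\<^sub>+(Q\<^sub>j)\<close> and above both \<open>\<lambda>\<^sub>+(Q\<^sub>j) - \<beta>\<close> and the Bohl exponent of \<open>P\<^sub>0\<close>. Far out on the half-line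
  the equation \<open>Y(x) = \<Phi>(x) Q\<^sub>j + \<integral>\<^sub>a\<^sup>x \<Phi>(x) P\<^sub>0 \<Phi>(s)\<^sup>-\<^sup>1 R(s) Y(s) ds - \<integral>\<^sub>x\<^sup>\<infinity> \<Phi>(x) P\<^sub>1 \<Phi>(s)\<^sup>-\<^sup>1 R(s) Y(s) ds\<close> is a
  contraction among functions of order \<open>exp ((\<gamma> + \<beta>) x)\<close>, and its integral terms are of order \<open>exp (\<gamma> x)\<close>.
  The solution is continued back to \<open>0\<close> and finally multiplied by \<open>Q\<^sub>j\<close> from the right, which
  keeps the asymptotics. Caratheodory solutions and integral equations are interchangeable by
  Lebesgue differentiation (Vitali covering and Henstock's lemma) and the fundamental theorem of
  calculus for absolutely continuous functions.
\<close>

section \<open>Absolutely continuous functions of one real variable\<close>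

text \<open>The obstacle is that \<open>\<Phi> Q\<^sub>j\<close> may grow faster than the rate below
  which the correction must stay, since \<open>\<lambda>\<^sub>+(Q\<^sub>j)\<close> can exceed
  \<open>\<kappa>'\<^sub>+(Q\<^sub>j)\<close>. Functions of order \<open>exp (\<gamma> x)\<close>
  need not contain the free term, so the fixed point is sought in a larger space, and the weight on
  \<open>R\<close> pays for the difference: if \<open>Y\<close> has order
  \<open>exp ((\<gamma> + \<beta>) s)\<close>, then \<open>R Y\<close> is
  \<open>exp (\<gamma> s)\<close> times an integrable function, and a kernel of order
  \<open>exp (\<gamma> (x - s))\<close> turns this into \<open>exp (\<gamma> x)\<close>. The kernel
  has this order for \<open>s \<le> x\<close> on blocks whose upper Bohl exponent is below \<gamma>,
  and for \<open>x \<le> s\<close> on blocks whose lower Bohl exponent is above \<gamma>. This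
  decides the splitting: no block lies below \<open>Q\<^sub>1\<close>, and only
  \<open>Q\<^sub>1\<close> lies below \<open>Q\<^sub>2\<close>. \<open>R\<close> is not assumed
  small; the contraction constant is the tail of its weighted integral, which is why the
  construction begins far out.\<close>

lemma cball_midpoint_real:
  "cball ((x + y) / 2) (\<bar>y - x\<bar> / 2) = {min x y..max x (y::real)}"
  unfolding cball_eq_atLeastAtMost by (auto simp: min_def max_def abs_if field_simps)

text \<open>Vitali covers the bad set, up to a null set, by disjoint intervals that have the tag as
  an end point and on which the defect exceeds \<open>c\<close> times the length. Henstock's lemma
  makes the total defect of such a family smaller than \<open>c * e\<close>, so the total length is
  at most \<open>e\<close>.\<close>

lemma negligible_difference_quotient_defect:
  fixes f :: "real \<Rightarrow> 'a::euclidean_space"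
  assumes f: "f integrable_on {a..b}" and "c > 0"
  shows "negligible {x \<in> {a..b}. \<forall>d>0. \<exists>y\<in>{a..b}. 0 < \<bar>y - x\<bar> \<and> \<bar>y - x\<bar> < d \<and>
           c * \<bar>y - x\<bar> < norm (integral {a..y} f - integral {a..x} f - (y - x) *\<^sub>R f x)}"
    (is "negligible ?E")
  unfolding negligible_outer_le
proof (intro allI impI)
  fix e :: real assume "e > 0"
  define defect where "defect x y = norm (integral {a..y} f - integral {a..x} f - (y - x) *\<^sub>R f x)" for x y
  define J where "J = (\<lambda>(x, y). {min x y..max x (y::real)})"
  define len where "len = (\<lambda>(x, y). \<bar>y - (x::real)\<bar>)"
  have "f integrable_on cbox a b" and "c * e > 0"
    using f \<open>c > 0\<close> \<open>e > 0\<close> by auto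
  then obtain \<gamma> where "gauge \<gamma>" and \<gamma>:
    "\<And>p. \<lbrakk>p tagged_partial_division_of (cbox a b); \<gamma> fine p\<rbrakk> \<Longrightarrow>
        (\<Sum>(x, K)\<in>p. norm (measure lborel K *\<^sub>R f x - integral K f)) < c * e"
    by (rule Henstock_lemma) blast
  \<comment> \<open>An interval is indexed by its tag \<open>x\<close> and its other end point
    \<open>y\<close>, which may lie on either side of \<open>x\<close>. Being inside
    \<open>\<gamma> x\<close> makes every finite disjoint subfamily admissible for Henstock's
    lemma.\<close>
  define I where "I = {(x, y). x \<in> {a..b} \<and> y \<in> {a..b} \<and> x \<noteq> y \<and> J (x, y) \<subseteq> \<gamma> x \<and>
                        c * \<bar>y - x\<bar> < defect x y}"
  \<comment> \<open>The covering theorem speaks of balls, so an interval becomes the ball about its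
    midpoint with half its length as radius.\<close>
  define ctr where "ctr = (\<lambda>(x, y). (x + y) / (2::real))"
  have J: "cball (ctr i) (len i / 2) = J i" for i
    by (cases i) (simp add: ctr_def len_def J_def cball_midpoint_real)
  obtain C where C: "countable C" "C \<subseteq> I"
    and pw: "pairwise (\<lambda>i j. disjnt (cball (ctr i) (len i / 2)) (cball (ctr j) (len j / 2))) C"
    and neg: "negligible (?E - (\<Union>i\<in>C. cball (ctr i) (len i / 2)))"
  proof (rule Vitali_covering_theorem_cballs[of I "\<lambda>i. len i / 2" ?E ctr])
    show "0 < len i / 2" if "i \<in> I" for i
      using that by (auto simp: I_def len_def)
    show "\<exists>i. i \<in> I \<and> x \<in> cball (ctr i) (len i / 2) \<and> len i / 2 < d" if "x \<in> ?E" "0 < d" for x d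
    proof -
      have "open (\<gamma> x)" "x \<in> \<gamma> x"
        using \<open>gauge \<gamma>\<close> by (auto simp: gauge_def)
      then obtain r where "r > 0" and r: "ball x r \<subseteq> \<gamma> x"
        by (meson openE)
      have "min r d > 0" using \<open>r > 0\<close> \<open>0 < d\<close> by simp
      with \<open>x \<in> ?E\<close> obtain y where y: "y \<in> {a..b}" "0 < \<bar>y - x\<bar>" "\<bar>y - x\<bar> < min r d"
          "c * \<bar>y - x\<bar> < defect x y"
        unfolding defect_def by blast
      have "J (x, y) \<subseteq> ball x r"
        using y by (auto simp: J_def dist_real_def)
      then have "(x, y) \<in> I"
        using y r that by (auto simp: I_def)
      moreover have "x \<in> J (x, y)" by (auto simp: J_def)
      moreover have "len (x, y) / 2 < d" using y by (auto simp: len_def)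
      ultimately show ?thesis unfolding J by blast
    qed
  qed auto
  have disj: "J i \<inter> J j = {}" if "i \<in> C" "j \<in> C" "i \<noteq> j" for i j
    using pw that unfolding pairwise_def J disjnt_def by blast
  \<comment> \<open>Henstock's lemma only sees finite families; the countable cover inherits the
    bound because it holds uniformly for all finite subfamilies.\<close>
  have lenle: "(\<Sum>i\<in>D. len i) \<le> e" if D: "D \<subseteq> C" "finite D" for D
  proof -
    let ?t = "\<lambda>i. (fst i, J i)"
    have inj: "inj_on ?t D"
    proof (rule inj_onI)
      fix i j assume "i \<in> D" "j \<in> D" "?t i = ?t j"
      moreover have "fst i \<in> J i" by (cases i) (auto simp: J_def)
      ultimately show "i = j" using disj[of i j] D by fastforce
    qed
    have tag: "?t ` D tagged_partial_division_of (cbox a b)"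
      unfolding tagged_partial_division_of_def
    proof (intro conjI allI impI)
      show "finite (?t ` D)" using D by simp
      fix x K assume "(x, K) \<in> ?t ` D"
      then obtain y where y: "(x, y) \<in> D" "K = J (x, y)" by force
      then have "(x, y) \<in> I" using D C by blast
      with y show "x \<in> K" "K \<subseteq> cbox a b" "\<exists>a b. K = cbox a b"
        by (auto simp: J_def I_def)
    next
      fix x1 K1 x2 K2 assume "(x1, K1) \<in> ?t ` D \<and> (x2, K2) \<in> ?t ` D \<and> (x1, K1) \<noteq> (x2, K2)"
      then obtain i j where "i \<in> D" "j \<in> D" "i \<noteq> j" "K1 = J i" "K2 = J j" by blast
      then have "K1 \<inter> K2 = {}" using disj D by blast
      then show "interior K1 \<inter> interior K2 = {}"
        by (meson disjoint_iff interior_subset subsetD)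
    qed
    have fine: "\<gamma> fine ?t ` D"
      using D C by (fastforce simp: fine_def I_def)
    have "c * (\<Sum>i\<in>D. len i) \<le> (\<Sum>i\<in>D. norm (measure lborel (J i) *\<^sub>R f (fst i) - integral (J i) f))"
      unfolding sum_distrib_left
    proof (rule sum_mono)
      fix i assume "i \<in> D"
      obtain x y where i: "i = (x, y)" by fastforce
      then have I: "(x, y) \<in> I" using \<open>i \<in> D\<close> D C by blast
      have int: "f integrable_on {u..v}" if "a \<le> u" "v \<le> b" for u v
        using f integrable_on_subinterval that by (metis atLeastatMost_subset_iff)
      have "norm (measure lborel (J i) *\<^sub>R f x - integral (J i) f) = defect x y"
      proof (cases "x \<le> y")
        case True
        have "integral {a..x} f + integral {x..y} f = integral {a..y} f"
          using I True int by (intro Henstock_Kurzweil_Integration.integral_combine) (auto simp: I_def)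
        then have *: "integral {x..y} f = integral {a..y} f - integral {a..x} f"
          by (simp add: algebra_simps)
        show ?thesis unfolding defect_def i J_def using True
          by (simp add: * norm_minus_commute)
      next
        case False
        have "integral {a..y} f + integral {y..x} f = integral {a..x} f"
          using I False int by (intro Henstock_Kurzweil_Integration.integral_combine) (auto simp: I_def)
        then have *: "integral {y..x} f = integral {a..x} f - integral {a..y} f"
          by (simp add: algebra_simps)
        show ?thesis unfolding defect_def i J_def using False
          by (simp add: * algebra_simps)
      qed
      then show "c * len i \<le> norm (measure lborel (J i) *\<^sub>R f (fst i) - integral (J i) f)"
        using I by (auto simp: I_def i len_def)
    qed
    also have "\<dots> = (\<Sum>(x, K)\<in>?t ` D. norm (measure lborel K *\<^sub>R f x - integral K f))"
      by (subst sum.reindex[OF inj]) (simp add: o_def)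
    also have "\<dots> < c * e" by (rule \<gamma>[OF tag fine])
    finally show ?thesis using \<open>c > 0\<close> by simp
  qed
  have Jmeas: "J i \<in> lmeasurable" "measure lebesgue (J i) = len i" for i
    by (auto simp: J_def len_def min_def max_def split: prod.splits)
  have fin: "measure lebesgue (\<Union>i\<in>D. J i) \<le> e" if "D \<subseteq> C" "finite D" for D
    using measure_UNION_le[of D J lebesgue] lenle[OF that] that Jmeas
    by (simp add: fmeasurableD)
  have T: "(\<Union>i\<in>C. J i) \<in> lmeasurable" "measure lebesgue (\<Union>i\<in>C. J i) \<le> e"
    using fmeasurable_UN_bound[OF C(1) Jmeas(1) fin] measure_UN_bound[OF C(1) Jmeas(1) fin] by auto
  show "\<exists>T. ?E \<subseteq> T \<and> T \<in> lmeasurable \<and> measure lebesgue T \<le> e"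
  proof (intro exI conjI)
    let ?N = "?E - (\<Union>i\<in>C. J i)"
    have N: "negligible ?N" using neg unfolding J .
    show "?E \<subseteq> ?N \<union> (\<Union>i\<in>C. J i)" by blast
    show "?N \<union> (\<Union>i\<in>C. J i) \<in> lmeasurable"
      using N T negligible_imp_measurable by blast
    have "measure lebesgue (?N \<union> (\<Union>i\<in>C. J i)) \<le> measure lebesgue ?N + measure lebesgue (\<Union>i\<in>C. J i)"
      using T N by (intro measure_Un_le) (auto intro: negligible_imp_sets fmeasurableD)
    also have "\<dots> \<le> e" using T negligible_imp_measure0[OF N] by simp
    finally show "measure lebesgue (?N \<union> (\<Union>i\<in>C. J i)) \<le> e" .
  qed
qed

text \<open>Outside the countable union of the defect sets for \<open>c = 1 / (n + 1)\<close>, the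
  difference quotient meets every tolerance.\<close>

lemma indefinite_integral_has_vector_derivative_AE:
  fixes f :: "real \<Rightarrow> 'a::euclidean_space"
  assumes f: "f integrable_on {a..b}"
  shows "AE x in lebesgue. x \<in> {a..b} \<longrightarrow>
           ((\<lambda>x. integral {a..x} f) has_vector_derivative f x) (at x within {a..b})"
proof -
  define E where "E n = {x \<in> {a..b}. \<forall>d>0. \<exists>y\<in>{a..b}. 0 < \<bar>y - x\<bar> \<and> \<bar>y - x\<bar> < d \<and>
           inverse (real (Suc n)) * \<bar>y - x\<bar> < norm (integral {a..y} f - integral {a..x} f - (y - x) *\<^sub>R f x)}" for n
  have "negligible (\<Union>n. E n)"
    unfolding E_def
    by (intro negligible_Union_nat negligible_difference_quotient_defect f) auto
  then have "AE x in lebesgue. x \<notin> (\<Union>n. E n)"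
    by (metis negligible_iff_null_sets AE_not_in)
  then show ?thesis
  proof (rule AE_mp, intro AE_I2 impI)
    fix x assume x: "x \<notin> (\<Union>n. E n)" "x \<in> {a..b}"
    show "((\<lambda>x. integral {a..x} f) has_vector_derivative f x) (at x within {a..b})"
      unfolding has_vector_derivative_def has_derivative_within_alt
    proof (intro conjI allI impI)
      show "bounded_linear (\<lambda>h. h *\<^sub>R f x)" by (rule bounded_linear_scaleR_left)
      fix e :: real assume "e > 0"
      then obtain n where n: "inverse (real (Suc n)) < e" using reals_Archimedean by blast
      from x have "x \<notin> E n" by blast
      then obtain d where d: "d > 0" and dd: "\<And>y. y \<in> {a..b} \<Longrightarrow> 0 < \<bar>y - x\<bar> \<Longrightarrow> \<bar>y - x\<bar> < d \<Longrightarrow>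
        norm (integral {a..y} f - integral {a..x} f - (y - x) *\<^sub>R f x) \<le> inverse (real (Suc n)) * \<bar>y - x\<bar>"
        using x(2) unfolding E_def mem_Collect_eq by (meson not_less)
      show "\<exists>d>0. \<forall>y\<in>{a..b}. norm (y - x) < d \<longrightarrow>
          norm (integral {a..y} f - integral {a..x} f - (y - x) *\<^sub>R f x) \<le> e * norm (y - x)"
      proof (intro exI[of _ d] conjI d ballI impI)
        fix y assume y: "y \<in> {a..b}" "norm (y - x) < d"
        show "norm (integral {a..y} f - integral {a..x} f - (y - x) *\<^sub>R f x) \<le> e * norm (y - x)"
        proof (cases "y = x")
          case False
          then have "norm (integral {a..y} f - integral {a..x} f - (y - x) *\<^sub>R f x) \<le> inverse (real (Suc n)) * \<bar>y - x\<bar>"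
            using y by (intro dd) auto
          also have "\<dots> \<le> e * \<bar>y - x\<bar>" using n by (intro mult_right_mono) auto
          finally show ?thesis by simp
        qed auto
      qed
    qed
  qed
qed

section \<open>Absolute continuity and the fundamental theorem of calculus\<close>

lemma sum_integral_division_le:
  fixes h :: "real \<Rightarrow> real"
  assumes D: "D division_of \<Union>D" "\<Union>D \<subseteq> {a..b}" and h: "h integrable_on {a..b}"
    and nn: "\<And>x. x \<in> {a..b} \<Longrightarrow> 0 \<le> h x"
  shows "(\<Sum>K\<in>D. integral K h) \<le> integral {a..b} h"
proof -
  have "h integrable_on K" if "K \<in> D" for K
  proof -
    obtain u v where "K = cbox u v" using division_ofD(4)[OF D(1)] \<open>K \<in> D\<close> by blast
    then show ?thesis using integrable_on_subinterval[OF h, of u v] D(2) that by (metis Sup_le_iff box_real(2))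
  qed
  then have hU: "(h has_integral (\<Sum>K\<in>D. integral K h)) (\<Union>D)"
    using D(1) by (intro has_integral_combine_division) auto
  then have "(\<Sum>K\<in>D. integral K h) = integral (\<Union>D) h" by (simp add: integral_unique)
  also have "\<dots> \<le> integral {a..b} h"
    using hU h D(2) nn by (intro integral_subset_le) auto
  finally show ?thesis .
qed

text \<open>The norm of \<open>f\<close> is at most \<open>n\<close> plus its excess
  \<open>h n\<close> over \<open>n\<close>. The excess has small integral for large \<open>n\<close>
  by dominated convergence, and the bounded part contributes at most \<open>n\<close> times the
  total length.\<close>

lemma absolutely_continuous_interval_indefinite_integral:
  fixes f :: "real \<Rightarrow> 'a::euclidean_space"
  assumes f: "f absolutely_integrable_on {a..b}"
  shows "absolutely_continuous_interval (\<lambda>x. integral {a..x} f) a b"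
  unfolding absolutely_continuous_interval_def
proof (intro allI impI)
  fix e :: real assume "e > 0"
  define h where "h n x = max (norm (f x) - real n) 0" for n x
  have nf: "(\<lambda>x. norm (f x)) absolutely_integrable_on {a..b}"
    using f absolutely_integrable_norm by (auto simp: o_def)
  have h_int: "h n integrable_on {a..b}" for n
  proof -
    have "(\<lambda>x. norm (f x) - real n) absolutely_integrable_on {a..b}"
      by (intro set_integral_diff(1) nf) auto
    from absolutely_integrable_max_1[OF this, of "\<lambda>_. 0"] show ?thesis
      unfolding h_def by (simp add: set_lebesgue_integral_eq_integral(1) set_integrable_def)
  qed
  have "(\<lambda>n. integral {a..b} (h n)) \<longlonglongrightarrow> integral {a..b} (\<lambda>x. 0)"
  proof (rule dominated_convergence(2)[OF h_int])
    show "(\<lambda>x. norm (f x)) integrable_on {a..b}"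
      using nf by (simp add: set_lebesgue_integral_eq_integral(1))
    show "norm (h n x) \<le> norm (f x)" for n x by (auto simp: h_def)
    fix x
    have "eventually (\<lambda>n. h n x = 0) sequentially"
      using eventually_ge_at_top[of "nat \<lceil>norm (f x)\<rceil>"]
      by eventually_elim (simp add: h_def nat_le_iff ceiling_le_iff)
    then show "(\<lambda>n. h n x) \<longlonglongrightarrow> 0" by (rule tendsto_eventually)
  qed
  then have "eventually (\<lambda>n. integral {a..b} (h n) < e / 2) sequentially"
    using \<open>e > 0\<close> by (intro order_tendstoD) auto
  then obtain n where n: "integral {a..b} (h n) < e / 2"
    by (auto simp: eventually_sequentially)
  show "\<exists>\<delta>>0. \<forall>D. D division_of \<Union>D \<and> \<Union>D \<subseteq> {a..b} \<and> (\<Sum>K\<in>D. Sup K - Inf K) < \<delta> \<longrightarrow>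
      (\<Sum>K\<in>D. norm (integral {a..Sup K} f - integral {a..Inf K} f)) < e"
  \<comment> \<open>The summand 1 keeps the denominator positive when \<open>n = 0\<close>.\<close>
  proof (intro exI[of _ "e / (2 * (real n + 1))"] conjI allI impI)
    show "0 < e / (2 * (real n + 1))" using \<open>e > 0\<close> by auto
    fix D assume "D division_of \<Union>D \<and> \<Union>D \<subseteq> {a..b} \<and> (\<Sum>K\<in>D. Sup K - Inf K) < e / (2 * (real n + 1))"
    then have D: "D division_of \<Union>D" "\<Union>D \<subseteq> {a..b}" "(\<Sum>K\<in>D. Sup K - Inf K) < e / (2 * (real n + 1))"
      by auto
    have "(\<Sum>K\<in>D. norm (integral {a..Sup K} f - integral {a..Inf K} f))
        \<le> (\<Sum>K\<in>D. integral K (h n) + real n * (Sup K - Inf K))"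
    proof (rule sum_mono)
      fix K assume "K \<in> D"
      then obtain u v where K: "K = {u..v}" "u \<le> v"
        using division_ofD(3,4)[OF D(1)] by (metis atLeastatMost_empty_iff2 box_real(2))
      with \<open>K \<in> D\<close> D(2) have uv: "a \<le> u" "v \<le> b" by (auto simp: Sup_le_iff)
      have fi: "f integrable_on {a..v}"
        using f uv integrable_on_subinterval[of f "{a..b}" a v] by (simp add: set_lebesgue_integral_eq_integral(1))
      have fK: "f absolutely_integrable_on {u..v}" "h n integrable_on {u..v}"
        using absolutely_integrable_on_subinterval[OF f, of u v] integrable_on_subinterval[OF h_int, of u v] uv by auto
      have "integral {a..v} f - integral {a..u} f = integral {u..v} f"
        using Henstock_Kurzweil_Integration.integral_combine[of a u v f] uv K fi by (simp add: algebra_simps)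
      then have "norm (integral {a..Sup K} f - integral {a..Inf K} f) = norm (integral {u..v} f)"
        using K by simp
      also have "\<dots> \<le> integral {u..v} (\<lambda>x. h n x + real n)"
      proof (rule integral_norm_bound_integral)
        show "f integrable_on {u..v}" using fK by (simp add: set_lebesgue_integral_eq_integral(1))
        show "(\<lambda>x. h n x + real n) integrable_on {u..v}" using fK by (intro integrable_add) auto
      qed (auto simp: h_def)
      also have "\<dots> = integral K (h n) + real n * (Sup K - Inf K)"
        using fK K by (subst integral_add) auto
      finally show "norm (integral {a..Sup K} f - integral {a..Inf K} f) \<le> integral K (h n) + real n * (Sup K - Inf K)" .
    qed
    also have "\<dots> = (\<Sum>K\<in>D. integral K (h n)) + real n * (\<Sum>K\<in>D. Sup K - Inf K)"
      by (simp add: sum.distrib sum_distrib_left)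
    also have "\<dots> \<le> integral {a..b} (h n) + real n * (e / (2 * (real n + 1)))"
      using D h_int by (intro add_mono sum_integral_division_le mult_left_mono) (auto simp: h_def)
    also have "\<dots> < e / 2 + e / 2"
    proof (rule add_less_le_mono[OF n])
      show "real n * (e / (2 * (real n + 1))) \<le> e / 2"
        using \<open>e > 0\<close> by (simp add: field_simps)
    qed
    finally show "(\<Sum>K\<in>D. norm (integral {a..Sup K} f - integral {a..Inf K} f)) < e" by simp
  qed
qed

text \<open>
  The points without derivative carry total length less than the \<open>\<delta>\<close> of absolute continuity when the
  gauge there is an open set of small measure; elsewhere the straddle estimate applies.
\<close>

lemma absolutely_continuous_interval_has_integral:
  fixes f :: "real \<Rightarrow> 'a::euclidean_space"
  assumes ac: "absolutely_continuous_interval f a b" and "a \<le> b"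
    and der: "AE x in lebesgue. x \<in> {a..b} \<longrightarrow> (f has_vector_derivative g x) (at x within {a..b})"
  shows "(g has_integral f b - f a) {a..b}"
proof -
  obtain N where N: "N \<in> null_sets lebesgue"
    and dN0: "\<And>x. x \<in> space lebesgue - N \<Longrightarrow> x \<in> {a..b} \<longrightarrow> (f has_vector_derivative g x) (at x within {a..b})"
    by (rule AE_E3[OF der]) blast
  have dN: "(f has_vector_derivative g x) (at x within {a..b})" if "x \<in> {a..b} - N" for x
    using dN0[of x] that by simp
  \<comment> \<open>With value 0 on the null set, the Riemann terms tagged there vanish and only the
    increments of \<open>f\<close> remain; at the end \<open>g\<close> and \<open>g'\<close> have
    the same integral.\<close>
  define g' where "g' x = (if x \<in> N then 0 else g x)" for x
  have "(g' has_integral f b - f a) {a..b}"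
    unfolding has_integral_real
  proof (intro allI impI)
    fix e :: real assume "e > 0"
    \<comment> \<open>The summand 1 covers \<open>a = b\<close> and makes
      \<open>e' * (b - a) < e / 2\<close> strict.\<close>
    define e' where "e' = e / (2 * (b - a + 1))"
    have e': "e' > 0" "e' * (b - a) < e / 2"
      using \<open>e > 0\<close> \<open>a \<le> b\<close> by (auto simp: e'_def field_simps)
    obtain \<delta> where "\<delta> > 0" and \<delta>: "\<And>D. D division_of \<Union>D \<Longrightarrow> \<Union>D \<subseteq> {a..b} \<Longrightarrow>
        (\<Sum>K\<in>D. Sup K - Inf K) < \<delta> \<Longrightarrow> (\<Sum>K\<in>D. norm (f (Sup K) - f (Inf K))) < e / 2"
      using ac \<open>e > 0\<close> unfolding absolutely_continuous_interval_def by (meson half_gt_zero)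
    obtain U where U: "open U" "N \<subseteq> U" "U - N \<in> lmeasurable" "emeasure lebesgue (U - N) < ennreal \<delta>"
      using sets_lebesgue_outer_open[of N \<delta>] N \<open>\<delta> > 0\<close> by auto
    have Um: "U \<in> lmeasurable" "measure lebesgue U < \<delta>"
    proof -
      have eq: "emeasure lebesgue U = emeasure lebesgue (U - N)"
        using N U emeasure_Diff_null_set[of N lebesgue U] by (auto simp: borel_open)
      show "U \<in> lmeasurable"
        using eq U by (auto simp: fmeasurable_def borel_open less_top[symmetric])
      then show "measure lebesgue U < \<delta>"
        using eq U \<open>\<delta> > 0\<close> by (metis emeasure_eq_measure2 ennreal_less_iff measure_nonneg)
    qed
    have "\<exists>d>0. \<forall>y\<in>{a..b}. \<bar>y - x\<bar> < d \<longrightarrow> norm (f y - f x - (y - x) *\<^sub>R g x) \<le> e' * \<bar>y - x\<bar>"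
      if "x \<in> {a..b} - N" for x
      using dN[OF that] e' unfolding has_vector_derivative_def has_derivative_within_alt by auto
    then obtain d where d: "\<And>x. x \<in> {a..b} - N \<Longrightarrow> d x > 0"
      and dd: "\<And>x y. x \<in> {a..b} - N \<Longrightarrow> y \<in> {a..b} \<Longrightarrow> \<bar>y - x\<bar> < d x \<Longrightarrow>
                 norm (f y - f x - (y - x) *\<^sub>R g x) \<le> e' * \<bar>y - x\<bar>"
      by metis
    \<comment> \<open>Intervals tagged in \<open>N\<close> stay inside \<open>U\<close>, whose
      measure is below \<delta>. The radius 1 outside the interval is a dummy, since a gauge is
      defined on the whole line.\<close>
    define \<gamma> where "\<gamma> x = (if x \<in> N then U else ball x (if x \<in> {a..b} then d x else 1))" for x
    show "\<exists>\<gamma>. gauge \<gamma> \<and> (\<forall>\<D>. \<D> tagged_division_of {a..b} \<and> \<gamma> fine \<D> \<longrightarrow>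
        norm ((\<Sum>(x, K)\<in>\<D>. measure lborel K *\<^sub>R g' x) - (f b - f a)) < e)"
    proof (intro exI[of _ \<gamma>] conjI allI impI)
      show "gauge \<gamma>" using U d by (auto simp: gauge_def \<gamma>_def)
      fix p assume "p tagged_division_of {a..b} \<and> \<gamma> fine p"
      then have p: "p tagged_division_of {a..b}" and fine: "\<gamma> fine p" by auto
      define pN where "pN = {t \<in> p. fst t \<in> N}"
      have finp: "finite p" and pN: "pN \<subseteq> p" "finite pN"
        using p by (auto simp: pN_def)
      have Kp: "\<exists>u v. K = {u..v} \<and> u \<le> x \<and> x \<le> v \<and> a \<le> u \<and> v \<le> b" if "(x, K) \<in> p" for x K
      proof -
        obtain u v where "K = cbox u v" using p \<open>(x, K) \<in> p\<close> by blast
        moreover have "x \<in> K" "K \<subseteq> {a..b}" using p \<open>(x, K) \<in> p\<close> by auto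
        ultimately show ?thesis by auto
      qed
      \<comment> \<open>The passage from tagged pairs to their intervals needs a summand that
        vanishes on every box without interior, because such boxes may carry several tags. One-point
        intervals give 0 anyway; the empty box needs the default.\<close>
      define q where "q K = (if K = {} then 0 else norm (f (Sup K) - f (Inf K)))" for K :: "real set"
      define D where "D = snd ` pN"
      have tN: "pN tagged_division_of \<Union>D"
        unfolding D_def
        using tagged_partial_division_of_Union_self tagged_partial_division_subset[OF _ pN(1)]
          tagged_division_of_def p by metis
      have Ddiv: "D division_of \<Union>D"
        using division_of_tagged_division[OF tN] by (simp add: D_def)
      have Dab: "\<Union>D \<subseteq> {a..b}"
        using tagged_division_ofD(3)[OF p] pN(1) unfolding D_def by force
      have DU: "\<Union>D \<subseteq> U"
      proof
        fix z assume "z \<in> \<Union>D"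
        then obtain x K where "(x, K) \<in> p" "x \<in> N" "z \<in> K" by (auto simp: D_def pN_def)
        then show "z \<in> U" using fineD[OF fine, of x K] by (auto simp: \<gamma>_def)
      qed
      have SI: "Sup K - Inf K = measure lebesgue K \<and> K \<noteq> {}" if "(x, K) \<in> p" for x K
        using Kp[OF that] by auto
      have "(\<Sum>K\<in>D. Sup K - Inf K) = (\<Sum>K\<in>D. measure lebesgue K)"
        using SI pN unfolding D_def by (intro sum.cong) auto
      also have "\<dots> = measure lebesgue (\<Union>D)"
        using content_division[OF Ddiv] by simp
      also have "\<dots> \<le> measure lebesgue U"
        using DU Um lmeasurable_division[OF Ddiv] by (intro measure_mono_fmeasurable) (auto intro: fmeasurableD)
      finally have "(\<Sum>K\<in>D. Sup K - Inf K) < \<delta>" using Um by simp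
      with \<delta> Ddiv Dab have *: "(\<Sum>K\<in>D. norm (f (Sup K) - f (Inf K))) < e / 2" by blast
      have "(\<Sum>(x, K)\<in>pN. norm (measure lborel K *\<^sub>R g' x - (f (Sup K) - f (Inf K)))) = (\<Sum>(x, K)\<in>pN. q K)"
      proof (rule sum.cong[OF refl], clarify)
        fix x K assume "(x, K) \<in> pN"
        then have "x \<in> N" "K \<noteq> {}" using SI pN by (auto simp: pN_def)
        then show "norm (measure lborel K *\<^sub>R g' x - (f (Sup K) - f (Inf K))) = q K"
          by (simp add: g'_def q_def norm_minus_commute)
      qed
      also have "\<dots> = sum q D"
        unfolding D_def
      proof (rule sum.over_tagged_division_lemma[OF tN])
        show "q (cbox u v) = 0" if "box u v = {}" for u v
          using that by (cases "u = v") (auto simp: q_def box_eq_empty)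
      qed
      also have "\<dots> = (\<Sum>K\<in>D. norm (f (Sup K) - f (Inf K)))"
        using SI pN unfolding D_def q_def by (intro sum.cong) auto
      finally have sN: "(\<Sum>(x, K)\<in>pN. norm (measure lborel K *\<^sub>R g' x - (f (Sup K) - f (Inf K)))) < e / 2"
        using * by simp
      have "(\<Sum>(x, K)\<in>p - pN. norm (measure lborel K *\<^sub>R g' x - (f (Sup K) - f (Inf K))))
          \<le> (\<Sum>(x, K)\<in>p - pN. e' * (Sup K - Inf K))"
      proof (rule sum_mono, clarify)
        fix x K assume xK: "(x, K) \<in> p" "(x, K) \<notin> pN"
        then obtain u v where K: "K = {u..v}" "u \<le> x" "x \<le> v" "a \<le> u" "v \<le> b" using Kp by blast
        have xN: "x \<in> {a..b} - N" using xK K by (auto simp: pN_def)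
        have "K \<subseteq> ball x (d x)" using fine xK xN by (fastforce simp: fine_def \<gamma>_def)
        then have uv: "u \<in> ball x (d x)" "v \<in> ball x (d x)"
          using K by (metis atLeastAtMost_iff order.refl order_trans subsetD)+
        \<comment> \<open>The increment is split at the tag. As the tag lies between
          \<open>u\<close> and \<open>v\<close>, the two error terms add up to \<open>e'\<close>
          times the length.\<close>
        have "measure lborel K *\<^sub>R g' x - (f (Sup K) - f (Inf K)) =
            (f u - f x - (u - x) *\<^sub>R g x) - (f v - f x - (v - x) *\<^sub>R g x)"
          using K xN by (simp add: g'_def algebra_simps)
        also have "norm \<dots> \<le> e' * \<bar>u - x\<bar> + e' * \<bar>v - x\<bar>"
          using uv K xN by (intro order_trans[OF norm_triangle_ineq4] add_mono dd) (auto simp: dist_real_def)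
        also have "\<dots> = e' * (Sup K - Inf K)" using K by (simp add: algebra_simps)
        finally show "norm (measure lborel K *\<^sub>R g' x - (f (Sup K) - f (Inf K))) \<le> e' * (Sup K - Inf K)" .
      qed
      also have "\<dots> \<le> (\<Sum>(x, K)\<in>p. e' * (Sup K - Inf K))"
        using finp e' Kp by (intro sum_mono2) fastforce+
      also have "\<dots> = e' * (\<Sum>(x, K)\<in>p. Sup K - Inf K)"
        by (simp add: sum_distrib_left case_prod_beta)
      also have "\<dots> = e' * (b - a)"
        using additive_tagged_division_1[OF \<open>a \<le> b\<close> p, of "\<lambda>x. x"] by simp
      finally have sC: "(\<Sum>(x, K)\<in>p - pN. norm (measure lborel K *\<^sub>R g' x - (f (Sup K) - f (Inf K)))) < e / 2"
        using e' by simp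
      have "(\<Sum>(x, K)\<in>p. measure lborel K *\<^sub>R g' x) - (f b - f a) =
          (\<Sum>(x, K)\<in>p. measure lborel K *\<^sub>R g' x - (f (Sup K) - f (Inf K)))"
        using additive_tagged_division_1[OF \<open>a \<le> b\<close> p, of f] by (simp add: sum_subtractf case_prod_beta)
      also have "norm \<dots> \<le> (\<Sum>(x, K)\<in>p. norm (measure lborel K *\<^sub>R g' x - (f (Sup K) - f (Inf K))))"
        by (intro sum_norm_le) auto
      also have "\<dots> = (\<Sum>(x, K)\<in>p - pN. norm (measure lborel K *\<^sub>R g' x - (f (Sup K) - f (Inf K)))) +
          (\<Sum>(x, K)\<in>pN. norm (measure lborel K *\<^sub>R g' x - (f (Sup K) - f (Inf K))))"
        by (rule sum.subset_diff[OF pN(1) finp])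
      also have "\<dots> < e" using sN sC by simp
      finally show "norm ((\<Sum>(x, K)\<in>p. measure lborel K *\<^sub>R g' x) - (f b - f a)) < e" .
    qed
  qed
  then show ?thesis
    by (rule has_integral_spike[of N, rotated 2]) (use N in \<open>auto simp: g'_def negligible_iff_null_sets\<close>)
qed

lemma absolutely_continuous_interval_imp_continuous_on:
  assumes "absolutely_continuous_interval f a b"
  shows "continuous_on {a..b} f"
  unfolding continuous_on_iff
proof (intro ballI allI impI)
  fix x e :: real assume x: "x \<in> {a..b}" and "e > 0"
  with assms obtain d where "d > 0" and d: "\<And>D. D division_of \<Union>D \<Longrightarrow> \<Union>D \<subseteq> {a..b} \<Longrightarrow>
        (\<Sum>K\<in>D. Sup K - Inf K) < d \<Longrightarrow> (\<Sum>K\<in>D. norm (f (Sup K) - f (Inf K))) < e"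
    unfolding absolutely_continuous_interval_def by meson
  have *: "norm (f v - f u) < e" if "a \<le> u" "u \<le> v" "v \<le> b" "v - u < d" for u v
    using d[of "{cbox u v}"] that by (auto simp: division_of_def)
  show "\<exists>d>0. \<forall>y\<in>{a..b}. dist y x < d \<longrightarrow> dist (f y) (f x) < e"
  proof (intro exI[of _ d] conjI ballI impI \<open>d > 0\<close>)
    fix y assume "y \<in> {a..b}" "dist y x < d"
    then show "dist (f y) (f x) < e"
      using *[of x y] *[of y x] x
      by (cases "x \<le> y") (auto simp: dist_norm norm_minus_commute)
  qed
qed

lemma absolutely_continuous_interval_subset:
  "absolutely_continuous_interval f a b \<Longrightarrow> {c..d} \<subseteq> {a..b} \<Longrightarrow> absolutely_continuous_interval f c d"
  unfolding absolutely_continuous_interval_def by (meson order_trans)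

lemma absolutely_continuous_interval_add_const:
  "absolutely_continuous_interval f a b \<Longrightarrow> absolutely_continuous_interval (\<lambda>x. c + f x) a b"
  unfolding absolutely_continuous_interval_def by simp

lemma absolutely_continuous_interval_cong:
  assumes f: "absolutely_continuous_interval f a b" and eq: "\<And>x. x \<in> {a..b} \<Longrightarrow> f x = g x"
  shows "absolutely_continuous_interval g a b"
  unfolding absolutely_continuous_interval_def
proof (intro allI impI)
  fix e :: real assume "e > 0"
  with f obtain d where "d > 0" and d: "\<And>D. D division_of \<Union>D \<Longrightarrow> \<Union>D \<subseteq> {a..b} \<Longrightarrow>
        (\<Sum>K\<in>D. Sup K - Inf K) < d \<Longrightarrow> (\<Sum>K\<in>D. norm (f (Sup K) - f (Inf K))) < e"
    unfolding absolutely_continuous_interval_def by meson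
  show "\<exists>d>0. \<forall>D. D division_of \<Union>D \<and> \<Union>D \<subseteq> {a..b} \<and> (\<Sum>K\<in>D. Sup K - Inf K) < d \<longrightarrow>
      (\<Sum>K\<in>D. norm (g (Sup K) - g (Inf K))) < e"
  proof (intro exI[of _ d] conjI \<open>d > 0\<close> allI impI, elim conjE)
    fix D assume D: "D division_of \<Union>D" "\<Union>D \<subseteq> {a..b}" "(\<Sum>K\<in>D. Sup K - Inf K) < d"
    have "(\<Sum>K\<in>D. norm (g (Sup K) - g (Inf K))) = (\<Sum>K\<in>D. norm (f (Sup K) - f (Inf K)))"
    proof (rule sum.cong[OF refl])
      fix K assume "K \<in> D"
      then obtain u v where "K = {u..v}" "u \<le> v" "{u..v} \<subseteq> {a..b}"
        using division_ofD(2,3,4)[OF D(1)] D(2) by (metis atLeastatMost_empty_iff2 box_real(2) order_trans)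
      then show "norm (g (Sup K) - g (Inf K)) = norm (f (Sup K) - f (Inf K))"
        by (simp add: eq)
    qed
    with d D show "(\<Sum>K\<in>D. norm (g (Sup K) - g (Inf K))) < e" by simp
  qed
qed

lemma absolutely_continuous_interval_bilinear:
  assumes h: "bounded_bilinear h"
    and f: "absolutely_continuous_interval f a b" and g: "absolutely_continuous_interval g a b"
  shows "absolutely_continuous_interval (\<lambda>x. h (f x) (g x)) a b"
proof -
  obtain K where K: "K > 0" "\<And>u v. norm (h u v) \<le> norm u * norm v * K"
    using bounded_bilinear.pos_bounded[OF h] by blast
  have "bounded (f ` {a..b})" "bounded (g ` {a..b})"
    using f g by (auto intro!: compact_imp_bounded compact_continuous_image
        absolutely_continuous_interval_imp_continuous_on)
  then obtain M N where MN: "M > 0" "N > 0"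
    "\<And>x. x \<in> {a..b} \<Longrightarrow> norm (f x) \<le> M" "\<And>x. x \<in> {a..b} \<Longrightarrow> norm (g x) \<le> N"
    unfolding bounded_pos by auto
  show ?thesis
    unfolding absolutely_continuous_interval_def
  proof (intro allI impI)
    fix e :: real assume "e > 0"
    \<comment> \<open>Each factor contributes \<open>e / 2\<close> after the other has been bounded
      by \<open>M\<close> or \<open>N\<close> and the bilinear map by \<open>K\<close>.\<close>
    define e1 where "e1 = e / (2 * N * K)"
    define e2 where "e2 = e / (2 * M * K)"
    have "e1 > 0" "e2 > 0" using \<open>e > 0\<close> MN K by (auto simp: e1_def e2_def)
    obtain d1 where d1: "d1 > 0" "\<And>D. D division_of \<Union>D \<Longrightarrow> \<Union>D \<subseteq> {a..b} \<Longrightarrow>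
        (\<Sum>K\<in>D. Sup K - Inf K) < d1 \<Longrightarrow> (\<Sum>K\<in>D. norm (f (Sup K) - f (Inf K))) < e1"
      using f \<open>e1 > 0\<close> unfolding absolutely_continuous_interval_def by meson
    obtain d2 where d2: "d2 > 0" "\<And>D. D division_of \<Union>D \<Longrightarrow> \<Union>D \<subseteq> {a..b} \<Longrightarrow>
        (\<Sum>K\<in>D. Sup K - Inf K) < d2 \<Longrightarrow> (\<Sum>K\<in>D. norm (g (Sup K) - g (Inf K))) < e2"
      using g \<open>e2 > 0\<close> unfolding absolutely_continuous_interval_def by meson
    show "\<exists>d>0. \<forall>D. D division_of \<Union>D \<and> \<Union>D \<subseteq> {a..b} \<and> (\<Sum>K\<in>D. Sup K - Inf K) < d \<longrightarrow>
      (\<Sum>K\<in>D. norm (h (f (Sup K)) (g (Sup K)) - h (f (Inf K)) (g (Inf K)))) < e"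
    proof (intro exI[of _ "min d1 d2"] conjI allI impI, goal_cases)
      case 1
      then show ?case using d1 d2 by simp
    next
      case (2 D)
      then have D: "D division_of \<Union>D" "\<Union>D \<subseteq> {a..b}"
        "(\<Sum>K\<in>D. Sup K - Inf K) < d1" "(\<Sum>K\<in>D. Sup K - Inf K) < d2"
        by auto
      have "(\<Sum>I\<in>D. norm (h (f (Sup I)) (g (Sup I)) - h (f (Inf I)) (g (Inf I))))
        \<le> (\<Sum>I\<in>D. N * K * norm (f (Sup I) - f (Inf I)) + M * K * norm (g (Sup I) - g (Inf I)))"
      proof (rule sum_mono)
        fix I assume "I \<in> D"
        then obtain u v where "I = {u..v}" "u \<le> v" "{u..v} \<subseteq> {a..b}"
          using division_ofD(2,3,4)[OF D(1)] D(2) by (metis atLeastatMost_empty_iff2 box_real(2) order_trans)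
        then have uv: "Sup I = v" "Inf I = u" "u \<in> {a..b}" "v \<in> {a..b}" by auto
        have "h (f v) (g v) - h (f u) (g u) = h (f v - f u) (g v) + h (f u) (g v - g u)"
          by (simp add: bounded_bilinear.diff_left[OF h] bounded_bilinear.diff_right[OF h])
        also have "norm \<dots> \<le> norm (f v - f u) * norm (g v) * K + norm (f u) * norm (g v - g u) * K"
          by (intro order_trans[OF norm_triangle_ineq] add_mono K)
        also have "\<dots> \<le> norm (f v - f u) * N * K + M * norm (g v - g u) * K"
          using MN uv K(1) by (intro add_mono mult_right_mono mult_left_mono) auto
        finally show "norm (h (f (Sup I)) (g (Sup I)) - h (f (Inf I)) (g (Inf I))) \<le>
            N * K * norm (f (Sup I) - f (Inf I)) + M * K * norm (g (Sup I) - g (Inf I))"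
          by (simp add: uv mult_ac)
      qed
      also have "\<dots> = N * K * (\<Sum>I\<in>D. norm (f (Sup I) - f (Inf I))) + M * K * (\<Sum>I\<in>D. norm (g (Sup I) - g (Inf I)))"
        by (simp add: sum.distrib sum_distrib_left)
      also have "\<dots> < N * K * e1 + M * K * e2"
        using D d1 d2 MN K by (intro add_strict_mono mult_strict_left_mono) auto
      also have "\<dots> = e" using MN K by (simp add: e1_def e2_def field_simps)
      finally show ?case .
    qed
  qed
qed

text \<open>The exceptional null sets of the intervals \<open>{c..c + n}\<close> are collected over
  all \<open>n\<close>; a point strictly left of \<open>c + n\<close> has the same one-sided
  neighbourhoods in \<open>{c..c + n}\<close> as in the half-line.\<close>

lemma indefinite_integral_half_line:
  fixes f :: "real \<Rightarrow> 'a::euclidean_space"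
  assumes f: "\<And>b. f absolutely_integrable_on {c..b}"
  shows "locally_absolutely_continuous_on {c..} (\<lambda>x. integral {c..x} f)"
    and "AE x in lebesgue. x \<in> {c..} \<longrightarrow>
           ((\<lambda>x. integral {c..x} f) has_vector_derivative f x) (at x within {c..})"
proof -
  show "locally_absolutely_continuous_on {c..} (\<lambda>x. integral {c..x} f)"
    unfolding locally_absolutely_continuous_on_def
  proof (intro allI impI)
    fix a b :: real assume ab: "{a..b} \<subseteq> {c..}"
    show "absolutely_continuous_interval (\<lambda>x. integral {c..x} f) a b"
      by (rule absolutely_continuous_interval_subset,
          rule absolutely_continuous_interval_indefinite_integral[OF f[of b]]) (use ab in auto)
  qed
  have "AE x in lebesgue. \<forall>n. x \<in> {c..c + real n} \<longrightarrow>
       ((\<lambda>x. integral {c..x} f) has_vector_derivative f x) (at x within {c..c + real n})"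
    unfolding AE_all_countable
    using f by (intro allI indefinite_integral_has_vector_derivative_AE)
      (simp add: set_lebesgue_integral_eq_integral(1))
  then show "AE x in lebesgue. x \<in> {c..} \<longrightarrow>
       ((\<lambda>x. integral {c..x} f) has_vector_derivative f x) (at x within {c..})"
  proof (rule AE_mp, intro AE_I2 impI)
    fix x assume x: "\<forall>n. x \<in> {c..c + real n} \<longrightarrow>
       ((\<lambda>x. integral {c..x} f) has_vector_derivative f x) (at x within {c..c + real n})" "x \<in> {c..}"
    obtain n where n: "x - c < real n" using reals_Archimedean2 by blast
    have "at x within {c..} = at x within {c..c + real n}"
      by (rule at_within_nhd[of _ "{..<c + real n}"]) (use n x in auto)
    then show "((\<lambda>x. integral {c..x} f) has_vector_derivative f x) (at x within {c..})"
      using x n by auto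
  qed
qed

section \<open>Matrix multiplication as a bounded bilinear map\<close>

text \<open>A row of the product is a combination of the rows of \<open>B\<close>, so Cauchy-Schwarz
  bounds it by the norm of the row of \<open>A\<close> times the norm of \<open>B\<close>; summing
  squares over the rows gives the Frobenius norm.\<close>

lemma norm_matrix_mult_le:
  fixes A :: "complex^'n^'m" and B :: "complex^'k^'n"
  shows "norm (A ** B) \<le> norm A * norm B"
proof -
  have row: "norm ((A ** B) $ i) \<le> norm (A $ i) * norm B" for i
  proof -
    have "(A ** B) $ i = (\<Sum>k\<in>UNIV. A $ i $ k *s B $ k)"
      by (simp add: vec_eq_iff matrix_matrix_mult_def)
    also have "norm \<dots> \<le> (\<Sum>k\<in>UNIV. norm (A $ i $ k) * norm (B $ k))"
    proof (intro sum_norm_le)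
      show "norm (A $ i $ k *s B $ k) \<le> norm (A $ i $ k) * norm (B $ k)" for k
        by (simp add: norm_vec_def L2_set_right_distrib norm_mult)
    qed
    also have "\<dots> \<le> norm (A $ i) * norm B"
      unfolding norm_vec_def[of "A $ i"] norm_vec_def[of B]
      using L2_set_mult_ineq[of "\<lambda>k. norm (A $ i $ k)" "\<lambda>k. norm (B $ k)" UNIV] by simp
    finally show ?thesis .
  qed
  have "norm (A ** B) = L2_set (\<lambda>i. norm ((A ** B) $ i)) UNIV" by (simp add: norm_vec_def)
  also have "\<dots> \<le> L2_set (\<lambda>i. norm (A $ i) * norm B) UNIV"
    by (intro L2_set_mono row) auto
  also have "\<dots> = norm A * norm B"
    unfolding norm_vec_def[of A] by (simp add: L2_set_left_distrib)
  finally show ?thesis .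
qed

lemma bounded_bilinear_matrix_mult:
  "bounded_bilinear ((**) :: complex^'n^'m \<Rightarrow> complex^'k^'n \<Rightarrow> complex^'k^'m)"
proof
  show "\<exists>K. \<forall>a b. norm ((a :: complex^'n^'m) ** (b :: complex^'k^'n)) \<le> norm a * norm b * K"
    by (intro exI[of _ 1]) (simp add: norm_matrix_mult_le)
qed (auto simp: matrix_matrix_mult_def vec_eq_iff algebra_simps sum.distrib scaleR_sum_right)

interpretation matrix_mult: bounded_bilinear "(**) :: complex^'n^'m \<Rightarrow> complex^'k^'n \<Rightarrow> complex^'k^'m"
  by (rule bounded_bilinear_matrix_mult)

section \<open>Linear integral equations\<close>

lemma absolutely_integrable_continuous_mult:
  fixes f :: "real \<Rightarrow> complex^'n^'m" and g :: "real \<Rightarrow> complex^'k^'n"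
  assumes "S \<in> sets lebesgue" "continuous_on S f" "bounded (f ` S)" "g absolutely_integrable_on S"
  shows "(\<lambda>x. f x ** g x) absolutely_integrable_on S"
proof (rule absolutely_integrable_bounded_measurable_product[where h = "(**)"])
  show "bilinear ((**) :: complex^'n^'m \<Rightarrow> complex^'k^'n \<Rightarrow> complex^'k^'m)"
    by (simp add: bilinear_conv_bounded_bilinear bounded_bilinear_matrix_mult)
qed (fact assms continuous_imp_measurable_on_sets_lebesgue[OF assms(2,1)])+

lemma absolutely_integrable_mult_continuous:
  fixes f :: "real \<Rightarrow> complex^'n^'m" and g :: "real \<Rightarrow> complex^'k^'n"
  assumes "S \<in> sets lebesgue" "continuous_on S g" "bounded (g ` S)" "f absolutely_integrable_on S"
  shows "(\<lambda>x. f x ** g x) absolutely_integrable_on S"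
proof (rule absolutely_integrable_bounded_measurable_product[where h = "\<lambda>x y. y ** x"])
  show "bilinear (\<lambda>(x :: complex^'k^'n) (y :: complex^'n^'m). y ** x)"
    by (simp add: bilinear_conv_bounded_bilinear bounded_bilinear.flip[OF bounded_bilinear_matrix_mult])
qed (fact assms continuous_imp_measurable_on_sets_lebesgue[OF assms(2,1)])+

lemma bounded_image_Icc: "continuous_on {a..b} f \<Longrightarrow> bounded (f ` {a..b})"
  for f :: "real \<Rightarrow> 'a::metric_space"
  by (intro compact_imp_bounded compact_continuous_image) auto

lemma integral_matrix_mult_left:
  fixes f :: "real \<Rightarrow> complex^'k^'n"
  assumes "f integrable_on S"
  shows "integral S (\<lambda>x. A ** f x) = (A :: complex^'n^'m) ** integral S f"
  using integral_linear[OF assms matrix_mult.bounded_linear_right] by (simp add: o_def)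

lemma integrable_matrix_mult_left:
  fixes f :: "real \<Rightarrow> complex^'k^'n"
  assumes "f integrable_on S"
  shows "(\<lambda>x. (A :: complex^'n^'m) ** f x) integrable_on S"
  using integrable_linear[OF assms matrix_mult.bounded_linear_right] by (simp add: o_def)

lemma matrix_solution_on_continuous_on:
  assumes "matrix_solution_on I B Y" "{a..b} \<subseteq> I"
  shows "continuous_on {a..b} Y"
  using assms absolutely_continuous_interval_imp_continuous_on
  unfolding matrix_solution_on_def locally_absolutely_continuous_on_def by blast

lemma continuous_on_atLeastI:
  fixes f :: "real \<Rightarrow> 'a::topological_space"
  assumes "\<And>b. continuous_on {a..b} f"
  shows "continuous_on {a..} f"
  unfolding continuous_on_eq_continuous_within
proof
  fix x assume "x \<in> {a..}"
  then have "continuous (at x within {a..x + 1}) f"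
    using assms[of "x + 1"] by (simp add: continuous_on_eq_continuous_within)
  moreover have "at x within {a..} = at x within {a..x + 1}"
    by (rule at_within_nhd[of _ "{..<x + 1}"]) auto
  ultimately show "continuous (at x within {a..}) f" by simp
qed

lemma matrix_solution_on_has_integral:
  assumes sol: "matrix_solution_on I B Y" and ab: "{a..b} \<subseteq> I" "a \<le> b"
  shows "((\<lambda>x. B x ** Y x) has_integral Y b - Y a) {a..b}"
proof (rule absolutely_continuous_interval_has_integral)
  show "absolutely_continuous_interval Y a b"
    using sol ab by (simp add: matrix_solution_on_def locally_absolutely_continuous_on_def)
  have "AE x in lebesgue. x \<in> I \<longrightarrow> (Y has_vector_derivative B x ** Y x) (at x within I)"
    using sol by (simp add: matrix_solution_on_def)
  then show "AE x in lebesgue. x \<in> {a..b} \<longrightarrow> (Y has_vector_derivative B x ** Y x) (at x within {a..b})"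
    by (rule AE_mp) (intro AE_I2 impI, use ab in \<open>blast intro: has_vector_derivative_within_subset\<close>)
qed fact

lemma matrix_solution_onI_integral:
  assumes Y: "continuous_on {c..} Y" and B: "\<And>b. B absolutely_integrable_on {c..b}"
    and eq: "\<And>x. c \<le> x \<Longrightarrow> Y x = Y0 + integral {c..x} (\<lambda>s. B s ** Y s)"
  shows "matrix_solution_on {c..} B Y"
proof -
  have "continuous_on {c..b} Y" for b
    using Y by (rule continuous_on_subset) auto
  then have BY: "(\<lambda>s. B s ** Y s) absolutely_integrable_on {c..b}" for b
    using B by (intro absolutely_integrable_mult_continuous bounded_image_Icc) auto
  note F = indefinite_integral_half_line[OF BY]
  show ?thesis
    unfolding matrix_solution_on_def
  proof
    show "locally_absolutely_continuous_on {c..} Y"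
      unfolding locally_absolutely_continuous_on_def
    proof (intro allI impI)
      fix a b assume ab: "{a..b} \<subseteq> {c..}"
      show "absolutely_continuous_interval Y a b"
      proof (rule absolutely_continuous_interval_cong)
        show "absolutely_continuous_interval (\<lambda>x. Y0 + integral {c..x} (\<lambda>s. B s ** Y s)) a b"
          using F(1) ab unfolding locally_absolutely_continuous_on_def
          by (intro absolutely_continuous_interval_add_const) blast
        show "Y0 + integral {c..x} (\<lambda>s. B s ** Y s) = Y x" if "x \<in> {a..b}" for x
          using eq[of x] ab that by (metis atLeast_iff subsetD)
      qed
    qed
    show "AE x in lebesgue. x \<in> {c..} \<longrightarrow> (Y has_vector_derivative B x ** Y x) (at x within {c..})"
    proof (rule AE_mp[OF F(2)], intro AE_I2 impI)
      fix x assume x: "x \<in> {c..} \<longrightarrow> ((\<lambda>x. integral {c..x} (\<lambda>s. B s ** Y s)) has_vector_derivative B x ** Y x)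
         (at x within {c..})" "x \<in> {c..}"
      then have "((\<lambda>x. Y0 + integral {c..x} (\<lambda>s. B s ** Y s)) has_vector_derivative 0 + B x ** Y x) (at x within {c..})"
        by (intro has_vector_derivative_add has_vector_derivative_const) auto
      then have "((\<lambda>x. Y0 + integral {c..x} (\<lambda>s. B s ** Y s)) has_vector_derivative B x ** Y x) (at x within {c..})"
        by simp
      from has_vector_derivative_transform[OF x(2) _ this] eq
      show "(Y has_vector_derivative B x ** Y x) (at x within {c..})"
        by auto
    qed
  qed
qed

section \<open>The Green operator of a splitting and its fixed points\<close>

lemma integral_atLeast_split:
  fixes h :: "real \<Rightarrow> 'b::euclidean_space"
  assumes h: "h absolutely_integrable_on {a..}" and "a \<le> x"
  shows "integral {a..} h = integral {a..x} h + integral {x..} h"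
proof -
  have "h absolutely_integrable_on {a..x}" "h absolutely_integrable_on {x..}"
    using \<open>a \<le> x\<close> by (intro set_integrable_subset[OF h]; simp)+
  then have "h integrable_on {a..x}" "h integrable_on {x..}"
    by (auto intro: set_lebesgue_integral_eq_integral(1))
  moreover have "{a..x} \<inter> {x..} = {x}" "{a..x} \<union> {x..} = {a..}" using \<open>a \<le> x\<close> by auto
  ultimately show ?thesis
    using integral_Un[of h "{a..x}" "{x..}"] by simp
qed

text \<open>The kernel is \<open>F x ** P ** E s\<close> for \<open>s \<le> x\<close> and
  \<open>- F x ** P' ** E s\<close> for \<open>s \<ge> x\<close>. \<open>E\<close> stands for the
  inverse of \<open>F\<close> up to scaling. The operator is used for the problem near infinity and,
  with all of \<open>F\<close>, \<open>E\<close>, \<open>P'\<close> equal to the identity and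
  \<open>P = 0\<close>, for continuing a solution backwards.\<close>

definition green_op ::
  "real \<Rightarrow> (real \<Rightarrow> ('d::finite) cmat) \<Rightarrow> 'd cmat \<Rightarrow> 'd cmat \<Rightarrow> (real \<Rightarrow> 'd cmat) \<Rightarrow> (real \<Rightarrow> 'd cmat)
    \<Rightarrow> real \<Rightarrow> 'd cmat"
  where "green_op a F P P' E g x =
    F x ** (integral {a..x} (\<lambda>s. P ** E s ** g s) - integral {x..} (\<lambda>s. P' ** E s ** g s))"

context
  fixes a :: real and F E :: "real \<Rightarrow> ('d::finite) cmat" and P P' :: "'d cmat" and C C' :: real
  assumes F: "continuous_on {a..} F" and E: "continuous_on {a..} E"
    and bound: "\<And>x s. a \<le> s \<Longrightarrow> s \<le> x \<Longrightarrow> norm (F x ** P ** E s) \<le> C"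
    and bound': "\<And>x s. a \<le> x \<Longrightarrow> x \<le> s \<Longrightarrow> norm (F x ** P' ** E s) \<le> C"
    and bounded: "\<And>s. a \<le> s \<Longrightarrow> norm (P' ** E s) \<le> C'"
begin

text \<open>\<open>P ** E s\<close> is bounded only on compact intervals, by continuity, so its part
  stops at a finite \<open>b\<close>. For the tail, the hypothesis \<open>bounded\<close> is what
  lets the integral converge before \<open>F x\<close> is multiplied in.\<close>

lemma green_kernel_absolutely_integrable:
  assumes g: "g absolutely_integrable_on {a..}"
  shows "(\<lambda>s. P ** E s ** g s) absolutely_integrable_on {a..b}"
    and "(\<lambda>s. P' ** E s ** g s) absolutely_integrable_on {a..}"
proof -
  have "continuous_on {a..b} (\<lambda>s. P ** E s)"
    using E by (intro matrix_mult.continuous_on continuous_on_const) (auto intro: continuous_on_subset)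
  moreover have "g absolutely_integrable_on {a..b}"
    using g by (rule set_integrable_subset) auto
  ultimately show "(\<lambda>s. P ** E s ** g s) absolutely_integrable_on {a..b}"
    by (intro absolutely_integrable_continuous_mult bounded_image_Icc) auto
  have "bounded ((\<lambda>s. P' ** E s) ` {a..})"
    using bounded by (auto simp: bounded_iff)
  then show "(\<lambda>s. P' ** E s ** g s) absolutely_integrable_on {a..}"
    using g E by (intro absolutely_integrable_continuous_mult matrix_mult.continuous_on continuous_on_const) auto
qed

lemma green_kernel_integrable:
  assumes g: "g absolutely_integrable_on {a..}"
  shows "(\<lambda>s. P ** E s ** g s) integrable_on {a..b}"
    and "(\<lambda>s. P' ** E s ** g s) integrable_on {a..}"
    and "(\<lambda>s. P' ** E s ** g s) integrable_on {a..b}"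
    and "a \<le> x \<Longrightarrow> (\<lambda>s. P' ** E s ** g s) integrable_on {x..}"
proof -
  note k = green_kernel_absolutely_integrable[OF g]
  show "(\<lambda>s. P ** E s ** g s) integrable_on {a..b}"
    by (rule set_lebesgue_integral_eq_integral(1)[OF k(1)])
  show "(\<lambda>s. P' ** E s ** g s) integrable_on {a..}"
    by (rule set_lebesgue_integral_eq_integral(1)[OF k(2)])
  have "(\<lambda>s. P' ** E s ** g s) absolutely_integrable_on {a..b}"
    by (rule set_integrable_subset[OF k(2)]) auto
  then show "(\<lambda>s. P' ** E s ** g s) integrable_on {a..b}"
    by (rule set_lebesgue_integral_eq_integral(1))
  assume "a \<le> x"
  then have "(\<lambda>s. P' ** E s ** g s) absolutely_integrable_on {x..}"
    by (intro set_integrable_subset[OF k(2)]) auto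
  then show "(\<lambda>s. P' ** E s ** g s) integrable_on {x..}"
    by (rule set_lebesgue_integral_eq_integral(1))
qed

text \<open>Completing the tail to an integral over the whole half-line leaves \<open>x\<close> only
  in \<open>F\<close> and in the upper limit of a finite integral. Continuity and the differential
  equation can be read off from this form.\<close>

lemma green_op_eq:
  assumes g: "g absolutely_integrable_on {a..}" and "a \<le> x"
  shows "green_op a F P P' E g x =
    F x ** (integral {a..x} (\<lambda>s. (P + P') ** E s ** g s) - integral {a..} (\<lambda>s. P' ** E s ** g s))"
proof -
  have "integral {a..x} (\<lambda>s. (P + P') ** E s ** g s) =
      integral {a..x} (\<lambda>s. P ** E s ** g s) + integral {a..x} (\<lambda>s. P' ** E s ** g s)"
    using green_kernel_integrable[OF g]
    by (subst integral_add[symmetric]) (auto simp: matrix_mult.add_left)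
  then show ?thesis
    unfolding green_op_def integral_atLeast_split[OF green_kernel_absolutely_integrable(2)[OF g] \<open>a \<le> x\<close>]
    by (simp add: algebra_simps)
qed

lemma continuous_on_green_op:
  assumes g: "g absolutely_integrable_on {a..}"
  shows "continuous_on {a..} (green_op a F P P' E g)"
proof -
  have "(\<lambda>s. (P + P') ** E s ** g s) integrable_on {a..b}" for b
    using integrable_add[OF green_kernel_integrable(1,3)[OF g]] by (simp add: matrix_mult.add_left)
  then have "continuous_on {a..} (\<lambda>x. integral {a..x} (\<lambda>s. (P + P') ** E s ** g s))"
    by (intro continuous_on_atLeastI indefinite_integral_continuous_1)
  then have "continuous_on {a..} (\<lambda>x. F x ** (integral {a..x} (\<lambda>s. (P + P') ** E s ** g s)
                - integral {a..} (\<lambda>s. P' ** E s ** g s)))"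
    by (intro matrix_mult.continuous_on F continuous_on_diff continuous_on_const)
  then show ?thesis
    by (rule continuous_on_eq) (simp add: green_op_eq[OF g])
qed

lemma green_op_diff:
  assumes "g absolutely_integrable_on {a..}" "h absolutely_integrable_on {a..}" and "a \<le> x"
  shows "green_op a F P P' E g x - green_op a F P P' E h x = green_op a F P P' E (\<lambda>s. g s - h s) x"
  unfolding green_op_def matrix_mult.diff_right[symmetric]
  using assms by (simp add: matrix_mult.diff_right green_kernel_integrable integral_diff)

text \<open>Once \<open>F x\<close> is taken under the integral signs both kernels are at most
  \<open>C\<close>, and the ranges \<open>{a..x}\<close> and \<open>{x..}\<close> together give the
  full integral.\<close>

lemma norm_green_op_le:
  assumes g: "g absolutely_integrable_on {a..}" and "a \<le> x"
  shows "norm (green_op a F P P' E g x) \<le> C * integral {a..} (\<lambda>s. norm (g s))"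
proof -
  have ng: "(\<lambda>s. norm (g s)) absolutely_integrable_on {a..}"
    using absolutely_integrable_norm[OF g] by (simp add: o_def)
  then have ng': "(\<lambda>s. norm (g s)) integrable_on {a..x}" "(\<lambda>s. norm (g s)) integrable_on {x..}"
    using \<open>a \<le> x\<close>
    by (intro set_lebesgue_integral_eq_integral(1) set_integrable_subset[OF ng]; simp)+
  have "norm (F x ** integral {a..x} (\<lambda>s. P ** E s ** g s)) \<le> integral {a..x} (\<lambda>s. C * norm (g s))"
    unfolding integral_matrix_mult_left[OF green_kernel_integrable(1)[OF g], symmetric]
  proof (rule integral_norm_bound_integral)
    show "norm (F x ** (P ** E s ** g s)) \<le> C * norm (g s)" if "s \<in> {a..x}" for s
      using that order_trans[OF norm_matrix_mult_le mult_right_mono[OF bound[of s x]]]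
      by (simp add: matrix_mul_assoc)
  qed (use ng' in \<open>auto intro!: integrable_matrix_mult_left green_kernel_integrable g integrable_on_mult_right\<close>)
  moreover have "norm (F x ** integral {x..} (\<lambda>s. P' ** E s ** g s)) \<le> integral {x..} (\<lambda>s. C * norm (g s))"
    unfolding integral_matrix_mult_left[OF green_kernel_integrable(4)[OF g \<open>a \<le> x\<close>], symmetric]
  proof (rule integral_norm_bound_integral)
    show "norm (F x ** (P' ** E s ** g s)) \<le> C * norm (g s)" if "s \<in> {x..}" for s
      using that \<open>a \<le> x\<close> order_trans[OF norm_matrix_mult_le mult_right_mono[OF bound'[of x s]]]
      by (simp add: matrix_mul_assoc)
  qed (use ng' \<open>a \<le> x\<close> in \<open>auto intro!: integrable_matrix_mult_left green_kernel_integrable g integrable_on_mult_right\<close>)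
  ultimately show ?thesis
    unfolding green_op_def matrix_mult.diff_right integral_atLeast_split[OF ng \<open>a \<le> x\<close>]
    using norm_triangle_ineq4[of "F x ** integral {a..x} (\<lambda>s. P ** E s ** g s)" "F x ** integral {x..} (\<lambda>s. P' ** E s ** g s)"]
    by (simp add: distrib_left)
qed

text \<open>Banach's theorem in the space of bounded continuous functions: by \<open>small\<close>,
  the operator halves norms, and the weight \<open>w \<le> 1\<close> does no harm. The weight leaves
  room for the decaying factor that the rescaled perturbation problem puts in front of the Green
  operator.\<close>

proposition green_op_fixed_point:
  fixes S G :: "real \<Rightarrow> 'd cmat" and w :: "real \<Rightarrow> real"
  assumes S: "S absolutely_integrable_on {a..}"
    and small: "C * integral {a..} (\<lambda>s. norm (S s)) \<le> 1 / 2"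
    and G: "continuous_on {a..} G" "\<And>x. a \<le> x \<Longrightarrow> norm (G x) \<le> M"
    and w: "continuous_on {a..} w" "\<And>x. a \<le> x \<Longrightarrow> 0 \<le> w x" "\<And>x. a \<le> x \<Longrightarrow> w x \<le> 1"
  obtains u where "continuous_on {a..} u" "bounded (u ` {a..})"
    "\<And>x. a \<le> x \<Longrightarrow> u x = G x + w x *\<^sub>R green_op a F P P' E (\<lambda>s. S s ** u s) x"
proof -
  let ?K = "\<lambda>v. green_op a F P P' E (\<lambda>s. S s ** v s)"
  \<comment> \<open>The space of bounded continuous functions lives on the whole line, so everything
    is frozen at its value in \<open>a\<close> to the left of \<open>a\<close>.\<close>
  let ?T = "\<lambda>v x. G (max a x) + w (max a x) *\<^sub>R ?K v (max a x)"
  have C: "0 \<le> C" using bound[of a a] norm_ge_zero order_trans by blast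
  have Sv: "(\<lambda>s. S s ** v s) absolutely_integrable_on {a..}"
    if "continuous_on {a..} v" "\<And>x. norm (v x) \<le> m" for v m
    using that S by (intro absolutely_integrable_mult_continuous) (auto simp: bounded_iff)
  have Kle: "norm (?K v x) \<le> m / 2" if v: "continuous_on {a..} v" "\<And>x. norm (v x) \<le> m" and "a \<le> x" for v m x
  proof -
    have m: "0 \<le> m" using v(2) norm_ge_zero order_trans by blast
    have "norm (?K v x) \<le> C * integral {a..} (\<lambda>s. norm (S s ** v s))"
      by (rule norm_green_op_le[OF Sv[OF v] \<open>a \<le> x\<close>])
    also have "integral {a..} (\<lambda>s. norm (S s ** v s)) \<le> integral {a..} (\<lambda>s. norm (S s) * m)"
    proof (rule integral_le)
      show "(\<lambda>s. norm (S s ** v s)) integrable_on {a..}"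
        using absolutely_integrable_norm[OF Sv[OF v]] by (simp add: o_def set_lebesgue_integral_eq_integral(1))
      show "(\<lambda>s. norm (S s) * m) integrable_on {a..}"
        using absolutely_integrable_norm[OF S]
        by (intro integrable_on_mult_left) (simp add: o_def set_lebesgue_integral_eq_integral(1))
      show "norm (S s ** v s) \<le> norm (S s) * m" for s
        using norm_matrix_mult_le[of "S s" "v s"] v(2)[of s] mult_left_mono[of "norm (v s)" m "norm (S s)"] by simp
    qed
    also have "C * \<dots> = (C * integral {a..} (\<lambda>s. norm (S s))) * m" by simp
    also have "\<dots> \<le> 1 / 2 * m" using small m by (rule mult_right_mono)
    finally show ?thesis using C by (simp add: mult_left_mono)
  qed
  have bv: "continuous_on {a..} (apply_bcontfun \<phi>)" "norm (apply_bcontfun \<phi> x) \<le> norm \<phi>" for \<phi> :: "real \<Rightarrow>\<^sub>C 'd cmat" and x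
    using norm_bounded[of \<phi> x] by auto
  have Tb: "?T (apply_bcontfun \<phi>) \<in> bcontfun" for \<phi> :: "real \<Rightarrow>\<^sub>C 'd cmat"
  proof (rule bcontfun_normI)
    have "continuous_on {a..} (\<lambda>x. G x + w x *\<^sub>R ?K (apply_bcontfun \<phi>) x)"
      using G w by (intro continuous_on_add continuous_on_scaleR continuous_on_green_op Sv[OF bv])
    moreover have "continuous_on UNIV (\<lambda>x. max a x)" by (intro continuous_intros)
    ultimately show "continuous_on UNIV (?T (apply_bcontfun \<phi>))"
      using continuous_on_compose2[of "{a..}" _ UNIV "max a"] by fastforce
    fix x
    have "norm (?T (apply_bcontfun \<phi>) x) \<le> norm (G (max a x)) + \<bar>w (max a x)\<bar> * norm (?K (apply_bcontfun \<phi>) (max a x))"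
      by (rule order_trans[OF norm_triangle_ineq]) simp
    also have "\<dots> \<le> M + 1 * (norm \<phi> / 2)"
      using w(2,3)[of "max a x"] by (intro add_mono mult_mono G Kle bv) auto
    finally show "norm (?T (apply_bcontfun \<phi>) x) \<le> M + 1 * (norm \<phi> / 2)" .
  qed
  define T where "T \<phi> = Bcontfun (?T (apply_bcontfun \<phi>))" for \<phi> :: "real \<Rightarrow>\<^sub>C 'd cmat"
  have T: "apply_bcontfun (T \<phi>) x = ?T (apply_bcontfun \<phi>) x" for \<phi> x
    unfolding T_def by (simp add: Bcontfun_inverse[OF Tb])
  have "dist (T \<phi>) (T \<psi>) \<le> 1 / 2 * dist \<phi> \<psi>" for \<phi> \<psi>
  proof (rule dist_bound)
    fix x
    let ?v = "\<lambda>s. apply_bcontfun \<phi> s - apply_bcontfun \<psi> s"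
    have v: "continuous_on {a..} ?v" "norm (?v s) \<le> dist \<phi> \<psi>" for s
      using dist_bounded[of \<phi> s \<psi>] by (auto intro!: continuous_on_diff simp: dist_norm)
    have "dist (T \<phi> x) (T \<psi> x) = norm (w (max a x) *\<^sub>R (?K (apply_bcontfun \<phi>) (max a x) - ?K (apply_bcontfun \<psi>) (max a x)))"
      by (simp add: T dist_norm scaleR_diff_right)
    also have "?K (apply_bcontfun \<phi>) (max a x) - ?K (apply_bcontfun \<psi>) (max a x) = ?K ?v (max a x)"
      by (subst green_op_diff[OF Sv[OF bv] Sv[OF bv]]) (auto simp: matrix_mult.diff_right)
    also have "norm (w (max a x) *\<^sub>R ?K ?v (max a x)) \<le> 1 * (dist \<phi> \<psi> / 2)"
      unfolding norm_scaleR using w(2,3)[of "max a x"] by (intro mult_mono Kle v) auto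
    finally show "dist (T \<phi> x) (T \<psi> x) \<le> 1 / 2 * dist \<phi> \<psi>" by simp
  qed
  then have "\<exists>!\<phi>. T \<phi> = \<phi>" by (intro banach_fix_type[of "1/2"]) auto
  then obtain \<phi> where \<phi>: "T \<phi> = \<phi>" by blast
  show ?thesis
  proof (rule that[of "apply_bcontfun \<phi>"])
    show "continuous_on {a..} (apply_bcontfun \<phi>)" by (rule bv)
    show "bounded (apply_bcontfun \<phi> ` {a..})" using bv(2) by (auto simp: bounded_iff)
    show "apply_bcontfun \<phi> x = G x + w x *\<^sub>R ?K (apply_bcontfun \<phi>) x" if "a \<le> x" for x
      using T[of \<phi> x] that unfolding \<phi> by (simp add: max_def)
  qed
qed

end

section \<open>Invertibility and backward continuation of solutions\<close>

lemma matrix_inv_invertible: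
  assumes "invertible A"
  shows "A ** matrix_inv A = mat 1" "matrix_inv A ** A = mat 1"
  using someI_ex[OF assms[unfolded invertible_def]] unfolding matrix_inv_def by auto

text \<open>The indefinite integral of the norm is continuous on a compact interval, hence uniformly
  continuous. Halving \<open>d\<close> turns the strict distance bound into a weak one.\<close>

lemma small_integral_on_short_intervals:
  fixes B :: "real \<Rightarrow> 'a::euclidean_space"
  assumes B: "B absolutely_integrable_on {a..b}" and "e > 0"
  obtains d where "d > 0"
    "\<And>u v. a \<le> u \<Longrightarrow> u \<le> v \<Longrightarrow> v \<le> b \<Longrightarrow> v - u \<le> d \<Longrightarrow> integral {u..v} (\<lambda>s. norm (B s)) \<le> e"
proof -
  have nB: "(\<lambda>s. norm (B s)) integrable_on {a..b}"
    using absolutely_integrable_norm[OF B] by (simp add: o_def set_lebesgue_integral_eq_integral(1))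
  then have "uniformly_continuous_on {a..b} (\<lambda>x. integral {a..x} (\<lambda>s. norm (B s)))"
    by (intro compact_uniformly_continuous indefinite_integral_continuous_1) auto
  then obtain d where "d > 0" and d: "\<And>u v. u \<in> {a..b} \<Longrightarrow> v \<in> {a..b} \<Longrightarrow> dist v u < d \<Longrightarrow>
      dist (integral {a..v} (\<lambda>s. norm (B s))) (integral {a..u} (\<lambda>s. norm (B s))) < e"
    using \<open>e > 0\<close> unfolding uniformly_continuous_on_def by metis
  show ?thesis
  proof (rule that[of "d / 2"])
    show "d / 2 > 0" using \<open>d > 0\<close> by simp
    fix u v assume uv: "a \<le> u" "u \<le> v" "v \<le> b" "v - u \<le> d / 2"
    have "(\<lambda>s. norm (B s)) integrable_on {a..v}"
      using nB uv integrable_on_subinterval[of _ "{a..b}" a v] by simp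
    then have "integral {a..u} (\<lambda>s. norm (B s)) + integral {u..v} (\<lambda>s. norm (B s)) = integral {a..v} (\<lambda>s. norm (B s))"
      using uv by (intro Henstock_Kurzweil_Integration.integral_combine) auto
    moreover have "dist (integral {a..v} (\<lambda>s. norm (B s))) (integral {a..u} (\<lambda>s. norm (B s))) < e"
      using uv \<open>d > 0\<close> by (intro d) (auto simp: dist_real_def)
    ultimately show "integral {u..v} (\<lambda>s. norm (B s)) \<le> e" by (simp add: dist_real_def)
  qed
qed

text \<open>Descent along the points \<open>c - n d\<close>, clipped at 0. It globalizes statements
  that are proved only where the integral of the coefficient is small.\<close>

lemma backward_short_steps_induct [consumes 2, case_names start step]:
  fixes c d :: real
  assumes "d > 0" "0 \<le> c"
    and start: "Q c"
    and step: "\<And>u v. 0 \<le> u \<Longrightarrow> u \<le> v \<Longrightarrow> v \<le> c \<Longrightarrow> v - u \<le> d \<Longrightarrow> Q v \<Longrightarrow> Q u"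
  shows "Q 0"
proof -
  have Q: "Q (max 0 (c - real n * d))" for n
  proof (induction n)
    case 0
    then show ?case using \<open>0 \<le> c\<close> start by simp
  next
    case (Suc n)
    show ?case
      by (rule step[OF _ _ _ _ Suc]) (use \<open>d > 0\<close> \<open>0 \<le> c\<close> in \<open>auto simp: max_def algebra_simps\<close>)
  qed
  obtain n where "c < real n * d" using \<open>d > 0\<close> by (meson ex_less_of_nat_mult)
  then show ?thesis using Q[of n] by simp
qed

text \<open>Hypothesis \<open>eq\<close> at \<open>x = v\<close> contains \<open>Y v = 0\<close>. At
  a point \<open>z\<close> where the norm of \<open>Y\<close> is maximal, the integral equation
  gives \<open>norm (Y z) \<le> norm (Y z) / 2\<close>, so \<open>Y\<close> vanishes on the short
  interval.\<close>

lemma matrix_solution_zero_backward: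
  fixes Y :: "real \<Rightarrow> ('d::finite) cmat"
  assumes B: "B absolutely_integrable_on {u..v}" and "u \<le> v"
    and small: "integral {u..v} (\<lambda>s. norm (B s)) \<le> 1 / 2"
    and Y: "continuous_on {u..v} Y"
    and eq: "\<And>x. x \<in> {u..v} \<Longrightarrow> ((\<lambda>s. B s ** Y s) has_integral - Y x) {x..v}"
  shows "Y u = 0"
proof -
  have "continuous_on {u..v} (\<lambda>x. norm (Y x))" using Y by (rule continuous_on_norm)
  then obtain z where z: "z \<in> {u..v}" and M: "\<And>x. x \<in> {u..v} \<Longrightarrow> norm (Y x) \<le> norm (Y z)"
    using continuous_attains_sup[of "{u..v}" "\<lambda>x. norm (Y x)"] \<open>u \<le> v\<close> by auto
  have nB: "(\<lambda>s. norm (B s)) absolutely_integrable_on {u..v}"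
    using absolutely_integrable_norm[OF B] by (simp add: o_def)
  then have nB': "(\<lambda>s. norm (B s)) integrable_on {u..v}"
    by (rule set_lebesgue_integral_eq_integral(1))
  then have nBz: "(\<lambda>s. norm (B s)) integrable_on {z..v}"
    using z integrable_on_subinterval[of _ "{u..v}" z v] by simp
  have "norm (Y z) = norm (integral {z..v} (\<lambda>s. B s ** Y s))"
    using eq[OF z] by (simp add: integral_unique)
  also have "\<dots> \<le> integral {z..v} (\<lambda>s. norm (B s) * norm (Y z))"
  proof (rule integral_norm_bound_integral)
    show "(\<lambda>s. B s ** Y s) integrable_on {z..v}" using eq[OF z] by blast
    show "(\<lambda>s. norm (B s) * norm (Y z)) integrable_on {z..v}"
      using nBz by (rule integrable_on_mult_left)
    show "norm (B s ** Y s) \<le> norm (B s) * norm (Y z)" if "s \<in> {z..v}" for s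
      using that z M[of s] by (intro order_trans[OF norm_matrix_mult_le] mult_left_mono) auto
  qed
  also have "\<dots> = integral {z..v} (\<lambda>s. norm (B s)) * norm (Y z)" by simp
  also have "\<dots> \<le> 1 / 2 * norm (Y z)"
  proof (rule mult_right_mono)
    have "integral {z..v} (\<lambda>s. norm (B s)) \<le> integral {u..v} (\<lambda>s. norm (B s))"
      using z nBz nB' by (intro integral_subset_le) auto
    then show "integral {z..v} (\<lambda>s. norm (B s)) \<le> 1 / 2" using small by simp
  qed simp
  finally have "norm (Y z) \<le> 0" by simp
  with M[of u] \<open>u \<le> v\<close> show ?thesis by simp
qed

text \<open>If \<open>\<Phi> x ** X = 0\<close>, then the solution \<open>\<Phi> ** X\<close>
  vanishes at \<open>x\<close>, hence by backward uniqueness at 0, and there \<Phi> is invertible.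
  So \<Phi> at \<open>x\<close> has trivial kernel.\<close>

lemma matrix_solution_on_invertible:
  fixes \<Phi> :: "real \<Rightarrow> ('d::finite) cmat"
  assumes sol: "matrix_solution_on {0..} A \<Phi>" and A: "\<And>b. A absolutely_integrable_on {0..b}"
    and init: "invertible (\<Phi> 0)" and "0 \<le> x"
  shows "invertible (\<Phi> x)"
proof -
  have inj: "X = 0" if X: "\<Phi> x ** X = 0" for X :: "'d cmat"
  proof -
    obtain d where d: "d > 0" "\<And>u v. 0 \<le> u \<Longrightarrow> u \<le> v \<Longrightarrow> v \<le> x \<Longrightarrow> v - u \<le> d \<Longrightarrow>
        integral {u..v} (\<lambda>s. norm (A s)) \<le> 1 / 2"
      by (rule small_integral_on_short_intervals[OF A[of x], of "1/2"]) auto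
    have "\<Phi> 0 ** X = 0"
      using d(1) \<open>0 \<le> x\<close>
    proof (induction rule: backward_short_steps_induct[where Q = "\<lambda>u. \<Phi> u ** X = 0"])
      case start
      then show ?case by (rule X)
    next
      case (step u v)
      show ?case
      proof (rule matrix_solution_zero_backward[where B = A and v = v])
        show "A absolutely_integrable_on {u..v}"
          by (rule set_integrable_subset[OF A[of v]]) (use step in auto)
        show "integral {u..v} (\<lambda>s. norm (A s)) \<le> 1 / 2" using step by (intro d)
        show "continuous_on {u..v} (\<lambda>x. \<Phi> x ** X)"
          using step by (intro matrix_mult.continuous_on continuous_on_const
              matrix_solution_on_continuous_on[OF sol]) auto
        fix y assume y: "y \<in> {u..v}"
        have "((\<lambda>s. A s ** \<Phi> s) has_integral \<Phi> v - \<Phi> y) {y..v}"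
          using y step by (intro matrix_solution_on_has_integral[OF sol]) auto
        from has_integral_linear[OF this matrix_mult.bounded_linear_left[of X]]
        show "((\<lambda>s. A s ** (\<Phi> s ** X)) has_integral - (\<Phi> y ** X)) {y..v}"
          by (simp add: o_def matrix_mult.diff_left step matrix_mul_assoc)
      qed fact
    qed
    then show "X = 0"
      using init by (metis invertible_def matrix_mul_assoc matrix_mul_lid matrix_mult.zero_right)
  qed
  have "y = 0" if "\<Phi> x *v y = 0" for y
  proof -
    \<comment> \<open>The vector \<open>y\<close> is repeated in every column, so that the statement
      about matrices applies to it.\<close>
    have "\<Phi> x ** (\<chi> i j. y $ i) = 0"
      using that by (simp add: vec_eq_iff matrix_matrix_mult_def matrix_vector_mult_def)
    from inj[OF this] show "y = 0" by (simp add: vec_eq_iff)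
  qed
  then show ?thesis
    unfolding invertible_left_inverse matrix_left_invertible_ker by blast
qed

text \<open>Solves \<open>X x = Y v - \<integral>\<^sub>x\<^sup>v B X\<close> on the short interval
  by the fixed point result and glues \<open>X\<close> to \<open>Y\<close> at \<open>v\<close>,
  where both agree.\<close>

lemma matrix_solution_extend_step:
  fixes Y :: "real \<Rightarrow> ('d::finite) cmat"
  assumes B: "\<And>b. B absolutely_integrable_on {u..b}" and "u \<le> v"
    and small: "norm (mat 1 :: 'd cmat) * integral {u..v} (\<lambda>s. norm (B s)) \<le> 1 / 2"
    and Y: "continuous_on {v..} Y" and eq: "\<And>x. v \<le> x \<Longrightarrow> Y x = Y v + integral {v..x} (\<lambda>s. B s ** Y s)"
  obtains Z where "continuous_on {u..} Z" "\<And>x. v \<le> x \<Longrightarrow> Z x = Y x"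
    "\<And>x. u \<le> x \<Longrightarrow> Z x = Z u + integral {u..x} (\<lambda>s. B s ** Z s)"
proof -
  \<comment> \<open>Cutting \<open>B\<close> off outside \<open>{u..v}\<close> turns the integral to
    infinity in the Green operator into an integral up to \<open>v\<close>.\<close>
  define S where "S s = (if s \<in> {u..v} then B s else 0)" for s
  have Sv: "S absolutely_integrable_on {u..}"
  proof -
    have "S absolutely_integrable_on UNIV"
      unfolding S_def using B by (subst absolutely_integrable_restrict_UNIV) auto
    then show ?thesis by (rule set_integrable_subset) auto
  qed
  have int_S: "integral {x..} (\<lambda>s. if s \<in> {u..v} then f s else 0) = integral {x..v} f" if "u \<le> x"
    for x and f :: "real \<Rightarrow> 'b::euclidean_space"
  proof -
    have "{u..v} \<inter> {x..} = {x..v}" using that by auto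
    then show ?thesis by (simp only: Henstock_Kurzweil_Integration.integral_restrict_Int)
  qed
  have nS: "norm (S s) = (if s \<in> {u..v} then norm (B s) else 0)" for s by (simp add: S_def)
  \<comment> \<open>With \<open>P = 0\<close> and \<open>P'\<close> the identity only the tail part
    survives. The constant \<open>C\<close> is the Frobenius norm of the identity, which need not be
    1; this is the factor in the hypothesis \<open>small\<close>.\<close>
  obtain X where X: "continuous_on {u..} X"
    and Xeq: "\<And>x. u \<le> x \<Longrightarrow> X x = Y v + 1 *\<^sub>R green_op u (\<lambda>_. mat 1) 0 (mat 1) (\<lambda>_. mat 1) (\<lambda>s. S s ** X s) x"
    by (rule green_op_fixed_point[where a = u and F = "\<lambda>_. mat 1 :: 'd cmat" and E = "\<lambda>_. mat 1 :: 'd cmat"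
        and P = 0 and P' = "mat 1 :: 'd cmat" and C = "norm (mat 1 :: 'd cmat)" and C' = "norm (mat 1 :: 'd cmat)"
        and S = S and G = "\<lambda>_. Y v" and M = "norm (Y v)" and w = "\<lambda>_. 1"])
      (use small Sv int_S[of u "\<lambda>s. norm (B s)"] in \<open>auto simp: nS[abs_def]\<close>)
  have BX: "(\<lambda>s. B s ** X s) integrable_on {u'..b}" if "u \<le> u'" for u' b
  proof -
    have "B absolutely_integrable_on {u'..b}"
      using that by (intro set_integrable_subset[OF B[of b]]) auto
    moreover have "continuous_on {u'..b} X"
      using that by (intro continuous_on_subset[OF X]) auto
    ultimately show ?thesis
      by (intro set_lebesgue_integral_eq_integral(1) absolutely_integrable_mult_continuous bounded_image_Icc) auto
  qed
  have Xint: "X x = Y v - integral {x..v} (\<lambda>s. B s ** X s)" if "u \<le> x" for x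
  proof -
    have "(\<lambda>s. S s ** X s) = (\<lambda>s. if s \<in> {u..v} then B s ** X s else 0)"
      by (auto simp: S_def)
    then show ?thesis
      using Xeq[OF that] int_S[OF that, of "\<lambda>s. B s ** X s"] by (simp add: green_op_def)
  qed
  define Z where "Z x = (if x \<le> v then X x else Y x)" for x
  have Xv: "X v = Y v" using Xint[of v] \<open>u \<le> v\<close> by simp
  have Z1: "Z x = Z u + integral {u..x} (\<lambda>s. B s ** Z s)" if x: "x \<in> {u..v}" for x
  proof -
    have split: "integral {u..x} (\<lambda>s. B s ** X s) + integral {x..v} (\<lambda>s. B s ** X s) = integral {u..v} (\<lambda>s. B s ** X s)"
      using x BX by (intro Henstock_Kurzweil_Integration.integral_combine) auto
    have ZX: "integral {u..x} (\<lambda>s. B s ** Z s) = integral {u..x} (\<lambda>s. B s ** X s)"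
      using x by (intro integral_cong) (auto simp: Z_def)
    have "X x = X u + integral {u..x} (\<lambda>s. B s ** X s)"
      using Xint[of u] Xint[of x] x unfolding split[symmetric] by simp
    then show ?thesis
      unfolding ZX using x by (simp add: Z_def)
  qed
  show ?thesis
  proof (rule that[of Z])
    have "continuous_on ({u..v} \<union> {v..}) (\<lambda>x. if x \<le> v then X x else Y x)"
      using X Y Xv by (intro continuous_on_If) (auto intro: continuous_on_subset)
    moreover have "{u..v} \<union> {v..} = {u..}" using \<open>u \<le> v\<close> by auto
    ultimately show Zc: "continuous_on {u..} Z" unfolding Z_def by simp
    show ZY: "Z x = Y x" if "v \<le> x" for x using that Xv by (cases "x = v") (auto simp: Z_def)
    show "Z x = Z u + integral {u..x} (\<lambda>s. B s ** Z s)" if "u \<le> x" for x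
    proof (cases "x \<le> v")
      case True
      then show ?thesis using that by (intro Z1) auto
    next
      case False
      have "B absolutely_integrable_on {u..x}" by (rule B)
      then have "(\<lambda>s. B s ** Z s) integrable_on {u..x}"
        using continuous_on_subset[OF Zc, of "{u..x}"]
        by (intro set_lebesgue_integral_eq_integral(1) absolutely_integrable_mult_continuous bounded_image_Icc) auto
      then have "integral {u..v} (\<lambda>s. B s ** Z s) + integral {v..x} (\<lambda>s. B s ** Z s) = integral {u..x} (\<lambda>s. B s ** Z s)"
        using \<open>u \<le> v\<close> False by (intro Henstock_Kurzweil_Integration.integral_combine) auto
      moreover have "integral {v..x} (\<lambda>s. B s ** Z s) = integral {v..x} (\<lambda>s. B s ** Y s)"
        by (intro integral_cong) (auto simp: ZY)
      moreover have "Y v = Z u + integral {u..v} (\<lambda>s. B s ** Z s)"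
        using Z1[of v] ZY[of v] \<open>u \<le> v\<close> by simp
      ultimately show ?thesis
        using eq[of x] ZY[of x] False by (simp add: add.assoc)
    qed
  qed
qed

lemma matrix_solution_extend_to_0:
  fixes Y :: "real \<Rightarrow> ('d::finite) cmat"
  assumes sol: "matrix_solution_on {c..} B Y" and B: "\<And>b. B absolutely_integrable_on {0..b}" and "0 \<le> c"
  obtains Z where "matrix_solution_on {0..} B Z" "\<And>x. c \<le> x \<Longrightarrow> Z x = Y x"
proof -
  define K where "K = norm (mat 1 :: 'd cmat)"
  have "K \<ge> 0" by (simp add: K_def)
  then have "1 / (2 * (K + 1)) > 0" by simp
  \<comment> \<open>The bound makes \<open>K\<close> times the integral at most
    \<open>1 / 2\<close>, as the extension step demands; adding 1 to \<open>K\<close> lets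
    \<open>K \<ge> 0\<close> suffice.\<close>
  then obtain d where d: "d > 0" "\<And>u v. 0 \<le> u \<Longrightarrow> u \<le> v \<Longrightarrow> v \<le> c \<Longrightarrow> v - u \<le> d \<Longrightarrow>
      integral {u..v} (\<lambda>s. norm (B s)) \<le> 1 / (2 * (K + 1))"
    by (rule small_integral_on_short_intervals[OF B[of c]]) blast
  let ?Q = "\<lambda>u. \<exists>Z. continuous_on {u..} Z \<and> (\<forall>x\<ge>c. Z x = Y x) \<and>
      (\<forall>x\<ge>u. Z x = Z u + integral {u..x} (\<lambda>s. B s ** Z s))"
  have "?Q 0"
    using d(1) \<open>0 \<le> c\<close>
  proof (induction rule: backward_short_steps_induct[where Q = ?Q])
    case start
    have "continuous_on {c..} Y"
      by (intro continuous_on_atLeastI matrix_solution_on_continuous_on[OF sol]) auto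
    moreover have "Y x = Y c + integral {c..x} (\<lambda>s. B s ** Y s)" if "c \<le> x" for x
      using integral_unique[OF matrix_solution_on_has_integral[OF sol _ that]] by simp
    ultimately show ?case by blast
  next
    case (step u v)
    then obtain Z where Z: "continuous_on {v..} Z" "\<And>x. x \<ge> c \<Longrightarrow> Z x = Y x"
      "\<And>x. v \<le> x \<Longrightarrow> Z x = Z v + integral {v..x} (\<lambda>s. B s ** Z s)" by blast
    have "K * integral {u..v} (\<lambda>s. norm (B s)) \<le> K * (1 / (2 * (K + 1)))"
      using step \<open>K \<ge> 0\<close> by (intro mult_left_mono d)
    also have "\<dots> \<le> 1 / 2" using \<open>K \<ge> 0\<close> by (simp add: field_simps)
    finally have small: "norm (mat 1 :: 'd cmat) * integral {u..v} (\<lambda>s. norm (B s)) \<le> 1 / 2"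
      by (simp add: K_def)
    have Bu: "B absolutely_integrable_on {u..b}" for b
      by (rule set_integrable_subset[OF B[of b]]) (use step in auto)
    obtain Z' where Z': "continuous_on {u..} Z'" "\<And>x. v \<le> x \<Longrightarrow> Z' x = Z x"
      "\<And>x. u \<le> x \<Longrightarrow> Z' x = Z' u + integral {u..x} (\<lambda>s. B s ** Z' s)"
      by (rule matrix_solution_extend_step[OF Bu step(2) small Z(1,3)], assumption) (rule that)
    have "Z' x = Y x" if "x \<ge> c" for x
      using Z'(2)[of x] Z(2)[OF that] step(3) that by simp
    then show ?case using Z'(1,3) by blast
  qed
  then obtain Z where Z: "continuous_on {0..} Z" "\<And>x. x \<ge> c \<Longrightarrow> Z x = Y x"
      "\<And>x. x \<ge> 0 \<Longrightarrow> Z x = Z 0 + integral {0..x} (\<lambda>s. B s ** Z s)" by blast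
  have "matrix_solution_on {0..} B Z"
    by (rule matrix_solution_onI_integral[OF Z(1) B Z(3)])
  then show ?thesis using Z(2) by (rule that)
qed

section \<open>Tools on the half-line\<close>

text \<open>Exponential boundedness makes the inverse locally bounded, by writing the inverse at
  \<open>y\<close> as the inverse at \<open>x\<close> times
  \<open>\<Phi> x ** matrix_inv (\<Phi> y)\<close>. The identity
  \<open>J y - J x = J x (\<Phi> x - \<Phi> y) J y\<close> for the inverses \<open>J\<close> then
  transfers continuity from \<Phi>.\<close>

lemma continuous_on_matrix_inv_exponentially_bounded:
  fixes \<Phi> :: "real \<Rightarrow> ('d::finite) cmat"
  assumes bdd: "exponentially_bounded \<Phi>" and cont: "continuous_on I \<Phi>"
    and inv: "\<And>x. x \<in> I \<Longrightarrow> invertible (\<Phi> x)"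
  shows "continuous_on I (\<lambda>x. matrix_inv (\<Phi> x))"
proof -
  obtain M where M: "\<And>x x'. \<bar>x - x'\<bar> \<le> 1 \<Longrightarrow> norm (\<Phi> x ** matrix_inv (\<Phi> x')) \<le> M"
    using bdd unfolding exponentially_bounded_def bdd_above_def by blast
  have inv1: "\<Phi> x ** matrix_inv (\<Phi> x) = mat 1" "matrix_inv (\<Phi> x) ** \<Phi> x = mat 1" if "x \<in> I" for x
    using inv[OF that] by (auto intro: matrix_inv_invertible)
  show ?thesis
    unfolding continuous_on_def
  proof
    fix x assume x: "x \<in> I"
    let ?J = "\<lambda>y. matrix_inv (\<Phi> y)"
    show "(?J \<longlongrightarrow> ?J x) (at x within I)"
    proof (rule Lim_null[THEN iffD2], rule Lim_null_comparison)
      have "((\<lambda>y. \<Phi> x - \<Phi> y) \<longlongrightarrow> \<Phi> x - \<Phi> x) (at x within I)"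
        using cont x by (intro tendsto_diff tendsto_const) (auto simp: continuous_on_def)
      then have "((\<lambda>y. norm (\<Phi> x - \<Phi> y)) \<longlongrightarrow> 0) (at x within I)"
        using tendsto_norm_zero by auto
      then show "((\<lambda>y. norm (?J x) * norm (\<Phi> x - \<Phi> y) * (norm (?J x) * M)) \<longlongrightarrow> 0) (at x within I)"
        using tendsto_mult[OF tendsto_mult[OF tendsto_const[of "norm (?J x)"]] tendsto_const] by fastforce
      have "eventually (\<lambda>y. y \<in> I \<and> \<bar>x - y\<bar> \<le> 1) (at x within I)"
        unfolding eventually_at
        by (intro exI[of _ 1]) (auto simp: dist_real_def)
      then show "\<forall>\<^sub>F y in at x within I. norm (?J y - ?J x) \<le> norm (?J x) * norm (\<Phi> x - \<Phi> y) * (norm (?J x) * M)"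
      proof eventually_elim
        case (elim y)
        then have y: "y \<in> I" by simp
        have "?J y = ?J x ** (\<Phi> x ** ?J y)"
          using inv1[OF x] by (simp add: matrix_mul_assoc)
        then have "norm (?J y) \<le> norm (?J x) * norm (\<Phi> x ** ?J y)"
          by (metis norm_matrix_mult_le)
        also have "\<dots> \<le> norm (?J x) * M"
          using elim by (intro mult_left_mono M) auto
        finally have Jy: "norm (?J y) \<le> norm (?J x) * M" .
        have "?J y - ?J x = ?J x ** (\<Phi> x - \<Phi> y) ** ?J y"
          using inv1[OF x] inv1[OF y]
          by (simp add: matrix_mult.diff_left matrix_mult.diff_right matrix_mul_assoc[symmetric])
        also have "norm \<dots> \<le> norm (?J x ** (\<Phi> x - \<Phi> y)) * norm (?J y)"
          by (rule norm_matrix_mult_le)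
        also have "\<dots> \<le> norm (?J x) * norm (\<Phi> x - \<Phi> y) * (norm (?J x) * M)"
          by (intro mult_mono norm_matrix_mult_le Jy) auto
        finally show ?case .
      qed
    qed
  qed
qed

text \<open>Dominated convergence for the truncations to \<open>{a..a + n}\<close>; local
  integrability supplies the measurability that a pointwise bound alone would not give.\<close>

lemma absolutely_integrable_half_line:
  fixes f :: "real \<Rightarrow> 'a::euclidean_space"
  assumes f: "\<And>b. f absolutely_integrable_on {a..b}" and h: "h integrable_on {a..}"
    and le: "\<And>x. a \<le> x \<Longrightarrow> norm (f x) \<le> h x"
  shows "f absolutely_integrable_on {a..}"
proof (rule dominated_convergence_absolutely_integrable[OF _ h])
  let ?f = "\<lambda>n x. if x \<in> {a..a + real n} then f x else 0"
  show "?f n absolutely_integrable_on {a..}" for n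
  proof -
    have "?f n absolutely_integrable_on UNIV"
      using f by (subst absolutely_integrable_restrict_UNIV)
    then show ?thesis by (rule set_integrable_subset) auto
  qed
  show "norm (f x) \<le> h x" if "x \<in> {a..}" for x
    using le that by simp
  show "(\<lambda>n. ?f n x) \<longlonglongrightarrow> f x" if "x \<in> {a..}" for x
  proof (rule tendsto_eventually)
    show "\<forall>\<^sub>F n in sequentially. ?f n x = f x"
      using eventually_ge_at_top[of "nat \<lceil>x - a\<rceil>"]
      by eventually_elim (use that in \<open>simp add: nat_le_iff ceiling_le_iff\<close>)
  qed
qed

lemma integral_tail_small:
  fixes h :: "real \<Rightarrow> 'a::euclidean_space"
  assumes h: "h absolutely_integrable_on {c..}" and "e > 0"
  shows "\<forall>\<^sub>F a in at_top. norm (integral {a..} h) < e"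
proof -
  have "((\<lambda>b. set_lebesgue_integral lebesgue {c..b} h) \<longlongrightarrow> set_lebesgue_integral lebesgue {c..} h) at_top"
    by (rule tendsto_set_lebesgue_integral_at_top[OF _ h]) auto
  then have "\<forall>\<^sub>F b in at_top. dist (set_lebesgue_integral lebesgue {c..b} h) (set_lebesgue_integral lebesgue {c..} h) < e"
    using \<open>e > 0\<close> by (rule tendstoD)
  then show ?thesis
    using eventually_ge_at_top[of c]
  proof eventually_elim
    case (elim b)
    have "h absolutely_integrable_on {c..b}"
      by (rule set_integrable_subset[OF h]) auto
    then have "set_lebesgue_integral lebesgue {c..b} h = integral {c..b} h"
      by (rule set_lebesgue_integral_eq_integral(2))
    moreover have "set_lebesgue_integral lebesgue {c..} h = integral {c..} h"
      by (rule set_lebesgue_integral_eq_integral(2)[OF h])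
    ultimately show ?case
      using elim integral_atLeast_split[OF h \<open>c \<le> b\<close>] by (simp add: dist_norm norm_minus_commute)
  qed
qed

section \<open>Solving the perturbed equation\<close>

text \<open>The product rule for \<Phi> times an indefinite integral, valid almost everywhere.
  Writing the condition as \<open>\<Phi> x ** g x = R x ** Y x\<close> keeps the inverse of \<Phi>
  out of the argument.\<close>

lemma matrix_solution_variation_of_constants:
  fixes \<Phi> :: "real \<Rightarrow> ('d::finite) cmat"
  assumes \<Phi>: "matrix_solution_on {a..} A \<Phi>"
    and g: "\<And>b. g absolutely_integrable_on {a..b}"
    and Y: "\<And>x. a \<le> x \<Longrightarrow> Y x = \<Phi> x ** (K + integral {a..x} g)"
    and gY: "\<And>x. a \<le> x \<Longrightarrow> \<Phi> x ** g x = R x ** Y x"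
  shows "matrix_solution_on {a..} (\<lambda>x. A x + R x) Y"
  unfolding matrix_solution_on_def
proof
  let ?W = "\<lambda>x. K + integral {a..x} g"
  note W = indefinite_integral_half_line[OF g]
  show "locally_absolutely_continuous_on {a..} Y"
    unfolding locally_absolutely_continuous_on_def
  proof (intro allI impI)
    fix u v assume uv: "{u..v} \<subseteq> {a..}"
    show "absolutely_continuous_interval Y u v"
    proof (rule absolutely_continuous_interval_cong)
      show "absolutely_continuous_interval (\<lambda>x. \<Phi> x ** ?W x) u v"
        using \<Phi> W(1) uv
        unfolding matrix_solution_on_def locally_absolutely_continuous_on_def
        by (intro absolutely_continuous_interval_bilinear[OF bounded_bilinear_matrix_mult]
            absolutely_continuous_interval_add_const) blast+
      show "\<Phi> x ** ?W x = Y x" if "x \<in> {u..v}" for x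
        using Y[of x] uv that by (metis atLeast_iff subsetD)
    qed
  qed
  have "AE x in lebesgue. x \<in> {a..} \<longrightarrow> (\<Phi> has_vector_derivative A x ** \<Phi> x) (at x within {a..})"
    using \<Phi> by (simp add: matrix_solution_on_def)
  with W(2) show "AE x in lebesgue. x \<in> {a..} \<longrightarrow> (Y has_vector_derivative (A x + R x) ** Y x) (at x within {a..})"
  proof eventually_elim
    case (elim x)
    show ?case
    proof
      assume x: "x \<in> {a..}"
      have "(?W has_vector_derivative 0 + g x) (at x within {a..})"
        using elim x by (intro has_vector_derivative_add has_vector_derivative_const) auto
      moreover have "(\<Phi> has_vector_derivative A x ** \<Phi> x) (at x within {a..})"
        using elim x by auto
      ultimately have "((\<lambda>x. \<Phi> x ** ?W x) has_vector_derivative \<Phi> x ** (0 + g x) + A x ** \<Phi> x ** ?W x) (at x within {a..})"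
        by (intro matrix_mult.has_vector_derivative)
      also have "\<Phi> x ** (0 + g x) + A x ** \<Phi> x ** ?W x = (A x + R x) ** Y x"
        using Y[of x] gY[of x] x by (simp add: matrix_mult.add_left matrix_mul_assoc)
      finally have "((\<lambda>x. \<Phi> x ** ?W x) has_vector_derivative (A x + R x) ** Y x) (at x within {a..})" .
      from has_vector_derivative_transform[OF x _ this] Y
      show "(Y has_vector_derivative (A x + R x) ** Y x) (at x within {a..})" by auto
    qed
  qed
qed

lemma matrix_solution_on_subset:
  assumes "matrix_solution_on I A Y" "J \<subseteq> I"
  shows "matrix_solution_on J A Y"
  unfolding matrix_solution_on_def
proof
  show "locally_absolutely_continuous_on J Y"
    using assms unfolding matrix_solution_on_def locally_absolutely_continuous_on_def by blast
  have "AE x in lebesgue. x \<in> I \<longrightarrow> (Y has_vector_derivative A x ** Y x) (at x within I)"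
    using assms by (simp add: matrix_solution_on_def)
  then show "AE x in lebesgue. x \<in> J \<longrightarrow> (Y has_vector_derivative A x ** Y x) (at x within J)"
    by eventually_elim (use assms(2) in \<open>blast intro: has_vector_derivative_within_subset\<close>)
qed

text \<open>
  After rescaling by \<open>F x = exp (- \<gamma> x) \<Phi> x\<close> and \<open>u x = exp (- (\<gamma> + \<beta>) x) Y x\<close> the splitting rate becomes \<open>0\<close>
  and the fixed point equation takes place among bounded functions.
\<close>

proposition perturbed_solution_half_line:
  fixes A R \<Phi> :: "real \<Rightarrow> ('d::finite) cmat" and P P0 P1 :: "'d cmat"
  assumes \<Phi>: "matrix_solution_on {0..} A \<Phi>" and inv: "\<And>x. 0 \<le> x \<Longrightarrow> invertible (\<Phi> x)"
    and inv_cont: "continuous_on {0..} (\<lambda>x. matrix_inv (\<Phi> x))"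
    and A: "\<And>b. A absolutely_integrable_on {0..b}"
    and R: "\<And>b. R absolutely_integrable_on {0..b}"
    and R_weighted: "(\<lambda>x. exp (\<beta> * x) * norm (R x)) absolutely_integrable_on {0..}"
    and "\<beta> \<ge> 0"
    and split: "P0 + P1 = mat 1"
    and bound0: "\<And>x s. 0 \<le> s \<Longrightarrow> s \<le> x \<Longrightarrow> norm (\<Phi> x ** P0 ** matrix_inv (\<Phi> s)) \<le> C * exp (\<gamma> * (x - s))"
    and bound1: "\<And>x s. 0 \<le> x \<Longrightarrow> x \<le> s \<Longrightarrow> norm (\<Phi> x ** P1 ** matrix_inv (\<Phi> s)) \<le> C * exp (\<gamma> * (x - s))"
    and growth: "\<forall>\<^sub>F x in at_top. norm (\<Phi> x ** P) \<le> exp ((\<gamma> + \<beta>) * x)"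
  obtains Y D where "matrix_solution_on {0..} (\<lambda>x. A x + R x) Y"
    "\<forall>\<^sub>F x in at_top. norm (Y x - \<Phi> x ** P) \<le> D * exp (\<gamma> * x)"
proof -
  let ?J = "\<lambda>x. matrix_inv (\<Phi> x)"
  define S where "S s = exp (\<beta> * s) *\<^sub>R R s" for s
  define F where "F x = exp (- \<gamma> * x) *\<^sub>R \<Phi> x" for x
  define E where "E s = exp (\<gamma> * s) *\<^sub>R ?J s" for s
  have S0: "S absolutely_integrable_on {0..}"
  proof (rule absolutely_integrable_half_line)
    show "(\<lambda>x. exp (\<beta> * x) * norm (R x)) integrable_on {0..}"
      by (rule set_lebesgue_integral_eq_integral(1)[OF R_weighted])
    show "norm (S x) \<le> exp (\<beta> * x) * norm (R x)" for x by (simp add: S_def)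
    fix b
    have "continuous_on {0..b} (\<lambda>s. exp (\<beta> * s))" by (intro continuous_intros)
    then show "S absolutely_integrable_on {0..b}"
      unfolding S_def
      by (intro absolutely_integrable_bounded_measurable_product[OF _ _ _ bounded_image_Icc R]
          continuous_imp_measurable_on_sets_lebesgue)
        (auto simp: bilinear_conv_bounded_bilinear bounded_bilinear_scaleR)
  qed
  have C: "C \<ge> 0"
    using order_trans[OF norm_ge_zero bound0[of 0 0]] by simp
  have nS: "(\<lambda>s. norm (S s)) absolutely_integrable_on {0..}"
    using absolutely_integrable_norm[OF S0] by (simp add: o_def)
  \<comment> \<open>The starting point \<open>a\<close> has to make the weighted tail of
    \<open>R\<close> small against the kernel constant \<open>C\<close> and to have the growth bound
    of the free term valid everywhere beyond it. \<open>C + 1\<close> is used because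
    \<open>C\<close> may be 0.\<close>
  have "\<forall>\<^sub>F a in at_top. norm (integral {a..} (\<lambda>s. norm (S s))) < 1 / (2 * (C + 1))"
    using C by (intro integral_tail_small[OF nS]) auto
  moreover have "\<forall>\<^sub>F a in at_top. \<forall>x\<ge>a. norm (\<Phi> x ** P) \<le> exp ((\<gamma> + \<beta>) * x)"
    using growth by (rule eventually_all_ge_at_top)
  ultimately have "\<forall>\<^sub>F a in at_top. norm (integral {a..} (\<lambda>s. norm (S s))) < 1 / (2 * (C + 1)) \<and>
      (\<forall>x\<ge>a. norm (\<Phi> x ** P) \<le> exp ((\<gamma> + \<beta>) * x)) \<and> a \<ge> (0::real)"
    using eventually_ge_at_top[of 0] by eventually_elim auto
  from eventually_happens'[OF trivial_limit_at_top_linorder this]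
  obtain a where "norm (integral {a..} (\<lambda>s. norm (S s))) < 1 / (2 * (C + 1)) \<and>
      (\<forall>x\<ge>a. norm (\<Phi> x ** P) \<le> exp ((\<gamma> + \<beta>) * x)) \<and> a \<ge> 0" ..
  then have a: "a \<ge> 0" "norm (integral {a..} (\<lambda>s. norm (S s))) < 1 / (2 * (C + 1))"
    "\<And>x. x \<ge> a \<Longrightarrow> norm (\<Phi> x ** P) \<le> exp ((\<gamma> + \<beta>) * x)"
    by simp_all
  have sub: "{a..} \<subseteq> {0..}" using a by auto
  have \<Phi>c: "continuous_on {a..} \<Phi>"
    by (intro continuous_on_atLeastI matrix_solution_on_continuous_on[OF \<Phi>]) (use a in auto)
  have J: "\<Phi> x ** ?J x = mat 1" "?J x ** \<Phi> x = mat 1" if "a \<le> x" for x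
    using inv[of x] that a by (auto intro: matrix_inv_invertible)
  have S: "S absolutely_integrable_on {a..}"
    by (rule set_integrable_subset[OF S0]) (use sub in auto)
  have small: "C * integral {a..} (\<lambda>s. norm (S s)) \<le> 1 / 2"
  proof -
    have "C * integral {a..} (\<lambda>s. norm (S s)) \<le> C * (1 / (2 * (C + 1)))"
      using a(2) C by (intro mult_left_mono) auto
    also have "\<dots> \<le> 1 / 2" using C by (simp add: field_simps)
    finally show ?thesis .
  qed
  have Fc: "continuous_on {a..} F" and Ec: "continuous_on {a..} E"
    unfolding F_def E_def using \<Phi>c continuous_on_subset[OF inv_cont sub]
    by (auto intro!: continuous_intros)
  have FE: "F x ** Z ** E s = exp (\<gamma> * (s - x)) *\<^sub>R (\<Phi> x ** Z ** ?J s)" for x s Z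
    by (simp add: F_def E_def matrix_mult.scaleR_left matrix_mult.scaleR_right exp_add[symmetric] algebra_simps)
  have expc: "exp (\<gamma> * (s - x)) * (C * exp (\<gamma> * (x - s))) = C" for s x
    by (simp add: exp_add[symmetric] algebra_simps)
  have b0: "norm (F x ** P0 ** E s) \<le> C" if "a \<le> s" "s \<le> x" for x s
    using mult_left_mono[OF bound0[of s x], of "exp (\<gamma> * (s - x))"] that a by (simp add: FE expc)
  have b1: "norm (F x ** P1 ** E s) \<le> C" if "a \<le> x" "x \<le> s" for x s
    using mult_left_mono[OF bound1[of x s], of "exp (\<gamma> * (s - x))"] that a by (simp add: FE expc)
  \<comment> \<open>The kernel estimates always contain a factor \<open>F x\<close>. Taking
    \<open>x = a\<close> and removing \<open>F a\<close> by its inverse bounds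
    \<open>P1 ** E s\<close> alone.\<close>
  have b2: "norm (P1 ** E s) \<le> norm (exp (\<gamma> * a) *\<^sub>R ?J a) * C" if "a \<le> s" for s
  proof -
    have "P1 ** E s = (exp (\<gamma> * a) *\<^sub>R ?J a) ** (F a ** P1 ** E s)"
      by (simp add: F_def J matrix_mul_assoc matrix_mult.scaleR_left matrix_mult.scaleR_right exp_add[symmetric])
    also have "norm \<dots> \<le> norm (exp (\<gamma> * a) *\<^sub>R ?J a) * norm (F a ** P1 ** E s)"
      by (rule norm_matrix_mult_le)
    also have "\<dots> \<le> norm (exp (\<gamma> * a) *\<^sub>R ?J a) * C"
      using that by (intro mult_left_mono b1) auto
    finally show ?thesis .
  qed
  obtain u where u: "continuous_on {a..} u" "bounded (u ` {a..})"
    and ueq: "\<And>x. a \<le> x \<Longrightarrow> u x = exp (- (\<gamma> + \<beta>) * x) *\<^sub>R (\<Phi> x ** P) +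
        exp (- \<beta> * x) *\<^sub>R green_op a F P0 P1 E (\<lambda>s. S s ** u s) x"
  \<comment> \<open>Dividing the equation for \<open>Y\<close> by
    \<open>exp ((\<gamma> + \<beta>) x)\<close> leaves \<open>exp (- \<beta> x)\<close> in front of
    the Green term, whose own rate is \<gamma>. This weight is at most 1 because
    \<open>0 \<le> a\<close> and \<open>\<beta> \<ge> 0\<close>.\<close>
  proof (rule green_op_fixed_point[OF Fc Ec b0 b1 b2 S small,
        where G = "\<lambda>x. exp (- (\<gamma> + \<beta>) * x) *\<^sub>R (\<Phi> x ** P)" and w = "\<lambda>x. exp (- \<beta> * x)" and M = 1])
    show "continuous_on {a..} (\<lambda>x. exp (- (\<gamma> + \<beta>) * x) *\<^sub>R (\<Phi> x ** P))"
      by (intro continuous_intros matrix_mult.continuous_on \<Phi>c)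
    show "continuous_on {a..} (\<lambda>x. exp (- \<beta> * x))" by (intro continuous_intros)
    show "norm (exp (- (\<gamma> + \<beta>) * x) *\<^sub>R (\<Phi> x ** P)) \<le> 1" if "a \<le> x" for x
      using mult_left_mono[OF a(3)[OF that], of "exp (- (\<gamma> + \<beta>) * x)"]
      by (simp add: exp_add[symmetric] algebra_simps)
    show "exp (- \<beta> * x) \<le> 1" if "a \<le> x" for x using that a \<open>\<beta> \<ge> 0\<close> by simp
  qed auto
  define h where "h s = S s ** u s" for s
  have h: "h absolutely_integrable_on {a..}"
    unfolding h_def using S u by (intro absolutely_integrable_mult_continuous) auto
  define Y where "Y x = exp ((\<gamma> + \<beta>) * x) *\<^sub>R u x" for x
  have Yeq: "Y x = \<Phi> x ** P + exp (\<gamma> * x) *\<^sub>R green_op a F P0 P1 E h x" if "a \<le> x" for x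
    using ueq[OF that]
    by (simp add: Y_def h_def[abs_def] scaleR_add_right exp_add[symmetric] algebra_simps)
  have g: "(\<lambda>s. E s ** h s) absolutely_integrable_on {a..b}" for b
  proof -
    have "h absolutely_integrable_on {a..b}" by (rule set_integrable_subset[OF h]) auto
    moreover have "continuous_on {a..b} E" by (rule continuous_on_subset[OF Ec]) auto
    ultimately show ?thesis by (intro absolutely_integrable_continuous_mult bounded_image_Icc) auto
  qed
  have "matrix_solution_on {a..} (\<lambda>x. A x + R x) Y"
  proof (rule matrix_solution_variation_of_constants[OF matrix_solution_on_subset[OF \<Phi> sub] g])
    fix x assume x: "a \<le> x"
    \<comment> \<open>Since \<open>P0 + P1\<close> is the identity, the finite integral loses its
      projection and the tail becomes a constant matrix, which is the form required for variation of
      constants.\<close>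
    have "green_op a F P0 P1 E h x =
        F x ** (integral {a..x} (\<lambda>s. E s ** h s) - integral {a..} (\<lambda>s. P1 ** E s ** h s))"
      using green_op_eq[OF Fc Ec b0 b1 b2 h x] by (simp add: split)
    then have "exp (\<gamma> * x) *\<^sub>R green_op a F P0 P1 E h x =
        \<Phi> x ** (integral {a..x} (\<lambda>s. E s ** h s) - integral {a..} (\<lambda>s. P1 ** E s ** h s))"
      by (simp add: F_def matrix_mult.scaleR_left exp_add[symmetric])
    then show "Y x = \<Phi> x ** ((P - integral {a..} (\<lambda>s. P1 ** E s ** h s)) + integral {a..x} (\<lambda>s. E s ** h s))"
      unfolding Yeq[OF x] by (simp add: matrix_mult.add_right matrix_mult.diff_right)
    have "\<Phi> x ** (E x ** h x) = exp (\<gamma> * x) *\<^sub>R ((\<Phi> x ** ?J x) ** h x)"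
      by (simp add: E_def matrix_mult.scaleR_left matrix_mult.scaleR_right matrix_mul_assoc)
    also have "\<dots> = R x ** Y x"
      by (simp add: J[OF x] h_def S_def Y_def matrix_mult.scaleR_left matrix_mult.scaleR_right exp_add[symmetric] algebra_simps)
    finally show "\<Phi> x ** (E x ** h x) = R x ** Y x" .
  qed
  moreover have "(\<lambda>x. A x + R x) absolutely_integrable_on {0..b}" for b
    using A R by (rule set_integral_add(1))
  ultimately obtain Z where Z: "matrix_solution_on {0..} (\<lambda>x. A x + R x) Z" "\<And>x. a \<le> x \<Longrightarrow> Z x = Y x"
    using matrix_solution_extend_to_0[OF _ _ \<open>a \<ge> 0\<close>] by blast
  have "\<forall>\<^sub>F x in at_top. norm (Z x - \<Phi> x ** P) \<le> (C * integral {a..} (\<lambda>s. norm (h s))) * exp (\<gamma> * x)"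
    using eventually_ge_at_top[of a]
  proof eventually_elim
    case (elim x)
    show ?case
      using norm_green_op_le[OF Fc Ec b0 b1 b2 h elim] Yeq[OF elim] Z(2)[OF elim]
      by (simp add: mult.commute)
  qed
  with Z(1) show ?thesis by (rule that)
qed

section \<open>Bohl and Lyapunov exponents\<close>

text \<open>Translates between growth rates and exponential bounds. For \<open>t = 0\<close> both
  sides hold, thanks to the value \<open>-\<infinity>\<close> of the logarithm.\<close>

lemma elog_divide_le_iff:
  assumes "0 \<le> t" "0 < x"
  shows "elog t / ereal x \<le> ereal g \<longleftrightarrow> t \<le> exp (g * x)"
proof (cases "t = 0")
  case True
  then show ?thesis using assms by (simp add: elog_def)
next
  case False
  then have "t \<le> exp (g * x) \<longleftrightarrow> ln t \<le> g * x"
    using assms by (metis exp_le_cancel_iff exp_ln less_eq_real_def)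
  then show ?thesis
    using assms False by (simp add: elog_def pos_divide_le_eq)
qed

text \<open>The gap between \<gamma> and \<gamma>' absorbs the constant as soon as \<open>x\<close>
  exceeds \<open>ln D' / (\<gamma>' - \<gamma>)\<close>.\<close>

lemma growth_rate_leI:
  assumes F: "\<forall>\<^sub>F x in at_top. norm (F x) \<le> D * exp (\<gamma> * x)" and "\<gamma> < \<gamma>'"
  shows "growth_rate F \<le> ereal \<gamma>'"
  unfolding growth_rate_def
proof (rule Limsup_bounded)
  \<comment> \<open>\<open>D\<close> is not known to be positive, so it is enlarged before its
    logarithm is taken.\<close>
  define D' where "D' = max D 1"
  have "\<forall>\<^sub>F x in at_top. ln D' / (\<gamma>' - \<gamma>) \<le> x" by (rule eventually_ge_at_top)
  with F eventually_gt_at_top[of 0]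
  show "\<forall>\<^sub>F x in at_top. elog (norm (F x)) / ereal x \<le> ereal \<gamma>'"
  proof eventually_elim
    case (elim x)
    have "norm (F x) \<le> D' * exp (\<gamma> * x)"
      using elim(1) by (rule order_trans) (simp add: D'_def)
    also have "\<dots> = exp (ln D' + \<gamma> * x)" by (simp add: exp_add D'_def)
    also have "\<dots> \<le> exp (\<gamma>' * x)"
      using elim \<open>\<gamma> < \<gamma>'\<close> by (simp add: pos_divide_le_eq algebra_simps)
    finally show ?case using elim by (simp add: elog_divide_le_iff)
  qed
qed

lemma growth_rate_lessD:
  assumes "growth_rate F < ereal l"
  shows "\<forall>\<^sub>F x in at_top. norm (F x) \<le> exp (l * x)"
  using Limsup_lessD[OF assms[unfolded growth_rate_def]] eventually_gt_at_top[of 0]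
proof eventually_elim
  case (elim x)
  then show ?case using elog_divide_le_iff[OF norm_ge_zero elim(2), of "F x" l] by (simp add: less_imp_le)
qed

text \<open>Admissible rates are closed downwards: for \<open>x \<le> x'\<close> a smaller rate
  gives a larger bound. The absolute value of \<open>C\<close> is taken because its sign is
  unknown.\<close>

lemma bohl_lower_gtD:
  assumes "ereal \<kappa> < bohl_lower I \<Phi> P"
  shows "\<exists>C. \<forall>x\<in>I. \<forall>x'\<in>I. x \<le> x' \<longrightarrow> norm (\<Phi> x ** P ** matrix_inv (\<Phi> x')) \<le> C * exp (\<kappa> * (x - x'))"
proof -
  obtain k C where "\<kappa> < k" and C: "\<And>x x'. x \<in> I \<Longrightarrow> x' \<in> I \<Longrightarrow> x \<le> x' \<Longrightarrow>
      norm (\<Phi> x ** P ** matrix_inv (\<Phi> x')) \<le> C * exp (k * (x - x'))"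
    using assms unfolding bohl_lower_def less_Sup_iff by auto
  have "norm (\<Phi> x ** P ** matrix_inv (\<Phi> x')) \<le> \<bar>C\<bar> * exp (\<kappa> * (x - x'))"
    if "x \<in> I" "x' \<in> I" "x \<le> x'" for x x'
  proof (rule order_trans[OF C[OF that]])
    have "k * (x - x') \<le> \<kappa> * (x - x')"
      using \<open>\<kappa> < k\<close> that by (intro mult_right_mono_neg) auto
    then show "C * exp (k * (x - x')) \<le> \<bar>C\<bar> * exp (\<kappa> * (x - x'))"
      by (intro mult_mono) auto
  qed
  then show ?thesis by blast
qed

lemma bohl_upper_lessD:
  assumes "bohl_upper I \<Phi> P < ereal \<kappa>"
  shows "\<exists>C. \<forall>x\<in>I. \<forall>x'\<in>I. x' \<le> x \<longrightarrow> norm (\<Phi> x ** P ** matrix_inv (\<Phi> x')) \<le> C * exp (\<kappa> * (x - x'))"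
proof -
  obtain k C where "k < \<kappa>" and C: "\<And>x x'. x \<in> I \<Longrightarrow> x' \<in> I \<Longrightarrow> x' \<le> x \<Longrightarrow>
      norm (\<Phi> x ** P ** matrix_inv (\<Phi> x')) \<le> C * exp (k * (x - x'))"
    using assms unfolding bohl_upper_def Inf_less_iff by auto
  have "norm (\<Phi> x ** P ** matrix_inv (\<Phi> x')) \<le> \<bar>C\<bar> * exp (\<kappa> * (x - x'))"
    if "x \<in> I" "x' \<in> I" "x' \<le> x" for x x'
  proof (rule order_trans[OF C[OF that]])
    have "k * (x - x') \<le> \<kappa> * (x - x')"
      using \<open>k < \<kappa>\<close> that by (intro mult_right_mono) auto
    then show "C * exp (k * (x - x')) \<le> \<bar>C\<bar> * exp (\<kappa> * (x - x'))"
      by (intro mult_mono) auto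
  qed
  then show ?thesis by blast
qed

lemma bohl_lower_subset: "J \<subseteq> I \<Longrightarrow> bohl_lower I \<Phi> P \<le> bohl_lower J \<Phi> P"
  unfolding bohl_lower_def by (intro Sup_subset_mono image_mono) blast

lemma bohl_upper_subset: "J \<subseteq> I \<Longrightarrow> bohl_upper J \<Phi> P \<le> bohl_upper I \<Phi> P"
  unfolding bohl_upper_def by (intro Inf_superset_mono image_mono) blast

text \<open>For \<open>P = 0\<close> every rate is admissible, so the lower exponent is \<infinity>
  and the upper one is \<open>-\<infinity>\<close>; the rates 1 and 0 already show the
  contradiction.\<close>

lemma bohl_lower_le_bohl_upper_imp_nonzero:
  assumes "bohl_lower I \<Phi> P \<le> bohl_upper I \<Phi> P"
  shows "P \<noteq> 0"
proof
  assume "P = 0"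
  then have "ereal 1 \<le> bohl_lower I \<Phi> P" "bohl_upper I \<Phi> P \<le> ereal 0"
    unfolding bohl_lower_def bohl_upper_def
    by (intro Sup_upper Inf_lower imageI CollectI exI[of _ 0]; simp)+
  with assms have "ereal 1 \<le> ereal 0" by order
  then show False by simp
qed

lemma matrix_inv_mat_1 [simp]: "matrix_inv (mat 1 :: 'a::semiring_1^'n^'n) = mat 1"
  using matrix_inv_invertible(1)[of "mat 1 :: 'a^'n^'n"] by (simp add: invertible_def)

text \<open>Inserting \<open>matrix_inv (\<Phi> x) ** \<Phi> x\<close> between two copies of
  \<open>P\<close> bounds the norm of \<open>P\<close> by a product of order
  \<open>exp (- k x)\<close> and \<open>exp (l x)\<close>. If \<open>l < k\<close>, this tends to 0,
  which a nonzero projection forbids.\<close>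

lemma bohl_lower_le_upper_lyapunov:
  assumes init: "\<Phi> 0 = mat 1" and inv: "\<And>x. 0 \<le> x \<Longrightarrow> invertible (\<Phi> x)"
    and P: "projection P" "P \<noteq> 0"
  shows "bohl_lower {0..} \<Phi> P \<le> upper_lyapunov \<Phi> P"
proof (rule ccontr)
  assume "\<not> ?thesis"
  then have "upper_lyapunov \<Phi> P < bohl_lower {0..} \<Phi> P" by simp
  then obtain l where l: "upper_lyapunov \<Phi> P < ereal l" "ereal l < bohl_lower {0..} \<Phi> P"
    using ereal_dense2 by blast
  obtain k where k: "ereal l < ereal k" "ereal k < bohl_lower {0..} \<Phi> P"
    using ereal_dense2[OF l(2)] by blast
  obtain C where C0: "\<forall>x\<in>{0..}. \<forall>x'\<in>{0..}. x \<le> x' \<longrightarrow>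
      norm (\<Phi> x ** P ** matrix_inv (\<Phi> x')) \<le> C * exp (k * (x - x'))"
    using bohl_lower_gtD[OF k(2)] ..
  have C: "norm (P ** matrix_inv (\<Phi> x)) \<le> C * exp (- (k * x))" if "0 \<le> x" for x
    using bspec[OF bspec[OF C0, of 0], of x] that init by simp
  have "\<forall>\<^sub>F x in at_top. norm P \<le> C * exp ((l - k) * x)"
    using growth_rate_lessD[OF l(1)[unfolded upper_lyapunov_def]] eventually_ge_at_top[of 0]
  proof eventually_elim
    case (elim x)
    have "P = P ** (matrix_inv (\<Phi> x) ** \<Phi> x) ** P"
      using P(1) inv[of x] elim by (simp add: projection_def matrix_inv_invertible)
    then have "norm P = norm ((P ** matrix_inv (\<Phi> x)) ** (\<Phi> x ** P))"
      by (simp add: matrix_mul_assoc)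
    also have "\<dots> \<le> norm (P ** matrix_inv (\<Phi> x)) * norm (\<Phi> x ** P)"
      by (rule norm_matrix_mult_le)
    also have "\<dots> \<le> (C * exp (- (k * x))) * exp (l * x)"
      using elim C[of x] order_trans[OF norm_ge_zero C[of x]] by (intro mult_mono) auto
    also have "\<dots> = C * exp ((l - k) * x)"
      by (simp add: exp_add[symmetric] algebra_simps)
    finally show ?case .
  qed
  moreover have "((\<lambda>x. C * exp ((l - k) * x)) \<longlongrightarrow> C * 0) at_top"
    using k by (intro tendsto_mult tendsto_const filterlim_compose[OF exp_at_bot]
        filterlim_tendsto_neg_mult_at_bot[OF tendsto_const _ filterlim_ident]) auto
  ultimately have "norm P \<le> C * 0"
    by (intro tendsto_lowerbound) auto
  with P(2) show False by simp
qed

text \<open>The Bohl estimate with \<open>x' = 0\<close> is a bound on \<open>\<Phi> x ** P\<close>,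
  because \<open>\<Phi> 0\<close> is the identity.\<close>

lemma upper_lyapunov_le_bohl_upper:
  assumes init: "\<Phi> 0 = mat 1"
  shows "upper_lyapunov \<Phi> P \<le> bohl_upper {0..} \<Phi> P"
proof (rule ccontr)
  assume "\<not> ?thesis"
  then have "bohl_upper {0..} \<Phi> P < upper_lyapunov \<Phi> P" by simp
  then obtain k where k: "bohl_upper {0..} \<Phi> P < ereal k" "ereal k < upper_lyapunov \<Phi> P"
    using ereal_dense2 by blast
  obtain l where l: "ereal k < ereal l" "ereal l < upper_lyapunov \<Phi> P"
    using ereal_dense2[OF k(2)] by blast
  obtain C where C0: "\<forall>x\<in>{0..}. \<forall>x'\<in>{0..}. x' \<le> x \<longrightarrow>
      norm (\<Phi> x ** P ** matrix_inv (\<Phi> x')) \<le> C * exp (k * (x - x'))"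
    using bohl_upper_lessD[OF k(1)] ..
  have C: "norm (\<Phi> x ** P) \<le> C * exp (k * x)" if "0 \<le> x" for x
    using bspec[OF bspec[OF C0, of x], of 0] that init by simp
  have "upper_lyapunov \<Phi> P \<le> ereal l"
    unfolding upper_lyapunov_def
  proof (rule growth_rate_leI)
    show "\<forall>\<^sub>F x in at_top. norm (\<Phi> x ** P) \<le> C * exp (k * x)"
      using eventually_ge_at_top[of 0] by eventually_elim (rule C)
  qed (use l in simp)
  with l show False by simp
qed

lemma matrix_solution_on_mult_right:
  assumes Y: "matrix_solution_on I B Y"
  shows "matrix_solution_on I B (\<lambda>x. Y x ** P)"
  unfolding matrix_solution_on_def
proof
  have const: "absolutely_continuous_interval (\<lambda>x. P) a b" for a b
    unfolding absolutely_continuous_interval_def by (intro allI impI exI[of _ 1]) simp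
  show "locally_absolutely_continuous_on I (\<lambda>x. Y x ** P)"
    unfolding locally_absolutely_continuous_on_def
  proof (intro allI impI absolutely_continuous_interval_bilinear[OF bounded_bilinear_matrix_mult] const)
    fix a b assume "{a..b} \<subseteq> I"
    then show "absolutely_continuous_interval Y a b"
      using Y by (simp add: matrix_solution_on_def locally_absolutely_continuous_on_def)
  qed
  have "AE x in lebesgue. x \<in> I \<longrightarrow> (Y has_vector_derivative B x ** Y x) (at x within I)"
    using Y by (simp add: matrix_solution_on_def)
  then show "AE x in lebesgue. x \<in> I \<longrightarrow> ((\<lambda>x. Y x ** P) has_vector_derivative B x ** (Y x ** P)) (at x within I)"
  proof eventually_elim
    case (elim x)
    then show ?case
      using bounded_linear.has_vector_derivative[OF matrix_mult.bounded_linear_left[of P]]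
      by (auto simp: matrix_mul_assoc)
  qed
qed

section \<open>Generalized Jost solutions\<close>

context
  fixes A R \<Phi> :: "real \<Rightarrow> ('d::finite) cmat" and \<beta> :: real
  assumes A: "L1_loc A" and \<Phi>: "propagator A \<Phi>" and bdd: "exponentially_bounded \<Phi>"
    and R: "L1_loc R" "(\<lambda>x. exp (\<beta> * x) * norm (R x)) absolutely_integrable_on {0..}"
begin

lemma propagator_half_line:
  shows "\<Phi> 0 = mat 1" and "matrix_solution_on {0..} A \<Phi>" and "0 \<le> x \<Longrightarrow> invertible (\<Phi> x)"
proof -
  show init: "\<Phi> 0 = mat 1" and sol: "matrix_solution_on {0..} A \<Phi>"
    using \<Phi> by (auto simp: propagator_def intro: matrix_solution_on_subset)
  show "invertible (\<Phi> x)" if "0 \<le> x"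
  proof (rule matrix_solution_on_invertible[OF sol _ _ that])
    show "invertible (\<Phi> 0)" by (simp add: init invertible_def)
  qed (use A in \<open>simp add: L1_loc_def\<close>)
qed

lemma generalized_jost_solution_exists:
  assumes split: "P0 + P1 = mat 1" and P: "projection P"
    and "\<beta> \<ge> 0" and gap: "ereal \<gamma> < bohl_lower {0..} \<Phi> P" "upper_lyapunov \<Phi> P < ereal (\<gamma> + \<beta>)"
    and bound0: "\<exists>C. \<forall>x\<in>{0..}. \<forall>s\<in>{0..}. s \<le> x \<longrightarrow> norm (\<Phi> x ** P0 ** matrix_inv (\<Phi> s)) \<le> C * exp (\<gamma> * (x - s))"
    and bound1: "\<exists>C. \<forall>x\<in>{0..}. \<forall>s\<in>{0..}. x \<le> s \<longrightarrow> norm (\<Phi> x ** P1 ** matrix_inv (\<Phi> s)) \<le> C * exp (\<gamma> * (x - s))"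
  shows "\<exists>Y. generalized_jost_solution A R \<Phi> P Y"
proof -
  note \<Phi>0 = propagator_half_line
  have cont: "continuous_on {0..} \<Phi>"
    by (intro continuous_on_atLeastI matrix_solution_on_continuous_on[OF \<Phi>0(2)]) auto
  obtain C0 where "\<forall>x\<in>{0..}. \<forall>s\<in>{0..}. s \<le> x \<longrightarrow> norm (\<Phi> x ** P0 ** matrix_inv (\<Phi> s)) \<le> C0 * exp (\<gamma> * (x - s))"
    using bound0 ..
  then have C0: "norm (\<Phi> x ** P0 ** matrix_inv (\<Phi> s)) \<le> C0 * exp (\<gamma> * (x - s))" if "0 \<le> s" "s \<le> x" for x s
    using that by simp
  obtain C1 where "\<forall>x\<in>{0..}. \<forall>s\<in>{0..}. x \<le> s \<longrightarrow> norm (\<Phi> x ** P1 ** matrix_inv (\<Phi> s)) \<le> C1 * exp (\<gamma> * (x - s))"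
    using bound1 ..
  then have C1: "norm (\<Phi> x ** P1 ** matrix_inv (\<Phi> s)) \<le> C1 * exp (\<gamma> * (x - s))" if "0 \<le> x" "x \<le> s" for x s
    using that by simp
  have inv_cont: "continuous_on {0..} (\<lambda>x. matrix_inv (\<Phi> x))"
    using \<Phi>0(3) by (intro continuous_on_matrix_inv_exponentially_bounded[OF bdd cont]) auto
  obtain Y D where Y: "matrix_solution_on {0..} (\<lambda>x. A x + R x) Y"
    and D: "\<forall>\<^sub>F x in at_top. norm (Y x - \<Phi> x ** P) \<le> D * exp (\<gamma> * x)"
  proof (rule perturbed_solution_half_line[OF \<Phi>0(2,3) inv_cont _ _ R(2) \<open>\<beta> \<ge> 0\<close> split])
    show "A absolutely_integrable_on {0..b}" "R absolutely_integrable_on {0..b}" for b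
      using A R by (auto simp: L1_loc_def)
    show "norm (\<Phi> x ** P0 ** matrix_inv (\<Phi> s)) \<le> max C0 C1 * exp (\<gamma> * (x - s))" if "0 \<le> s" "s \<le> x" for x s
      using C0[OF that] by (rule order_trans) simp
    show "norm (\<Phi> x ** P1 ** matrix_inv (\<Phi> s)) \<le> max C0 C1 * exp (\<gamma> * (x - s))" if "0 \<le> x" "x \<le> s" for x s
      using C1[OF that] by (rule order_trans) simp
    show "\<forall>\<^sub>F x in at_top. norm (\<Phi> x ** P) \<le> exp ((\<gamma> + \<beta>) * x)"
      using gap(2) unfolding upper_lyapunov_def by (rule growth_rate_lessD)
  qed
  have PP: "X ** P ** P = X ** P" for X :: "'d cmat"
    using P by (simp add: projection_def matrix_mul_assoc[symmetric])
  \<comment> \<open>A second rate strictly between \<gamma> and the lower Bohl exponent absorbs the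
    constant \<open>D * norm P\<close> and keeps the final inequality strict.\<close>
  obtain \<gamma>' where \<gamma>': "ereal \<gamma> < ereal \<gamma>'" "ereal \<gamma>' < bohl_lower {0..} \<Phi> P"
    using ereal_dense2[OF gap(1)] by blast
  have "\<forall>\<^sub>F x in at_top. norm (Y x ** P - \<Phi> x ** P) \<le> (D * norm P) * exp (\<gamma> * x)"
    using D
  proof eventually_elim
    case (elim x)
    have "norm (Y x ** P - \<Phi> x ** P) = norm ((Y x - \<Phi> x ** P) ** P)"
      by (simp add: matrix_mult.diff_left PP)
    also have "\<dots> \<le> norm (Y x - \<Phi> x ** P) * norm P" by (rule norm_matrix_mult_le)
    also have "\<dots> \<le> (D * exp (\<gamma> * x)) * norm P" using elim by (rule mult_right_mono) simp
    finally show ?case by (simp add: mult_ac)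
  qed
  then have "growth_rate (\<lambda>x. Y x ** P - \<Phi> x ** P) \<le> ereal \<gamma>'"
    by (rule growth_rate_leI) (use \<gamma>' in simp)
  then have "growth_rate (\<lambda>x. Y x ** P - \<Phi> x ** P) < bohl_lower {0..} \<Phi> P"
    using \<gamma>'(2) by (rule le_less_trans)
  then have "generalized_jost_solution A R \<Phi> P (\<lambda>x. Y x ** P)"
    using matrix_solution_on_mult_right[OF Y] PP by (simp add: generalized_jost_solution_def)
  then show ?thesis by blast
qed

end

text \<open>The part \<open>P1\<close> of the splitting is a sum of several blocks. Assuming a mere
  bound, not an exponent, for the second summand lets the lemma be applied repeatedly.\<close>

lemma bohl_lower_bound_add:
  assumes "ereal \<gamma> < bohl_lower I \<Phi> P"
    and "\<exists>C. \<forall>x\<in>I. \<forall>x'\<in>I. x \<le> x' \<longrightarrow> norm (\<Phi> x ** P' ** matrix_inv (\<Phi> x')) \<le> C * exp (\<gamma> * (x - x'))"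
  shows "\<exists>C. \<forall>x\<in>I. \<forall>x'\<in>I. x \<le> x' \<longrightarrow> norm (\<Phi> x ** (P + P') ** matrix_inv (\<Phi> x')) \<le> C * exp (\<gamma> * (x - x'))"
proof -
  obtain C C' where
    "\<And>x x'. x \<in> I \<Longrightarrow> x' \<in> I \<Longrightarrow> x \<le> x' \<Longrightarrow> norm (\<Phi> x ** P ** matrix_inv (\<Phi> x')) \<le> C * exp (\<gamma> * (x - x'))"
    "\<And>x x'. x \<in> I \<Longrightarrow> x' \<in> I \<Longrightarrow> x \<le> x' \<Longrightarrow> norm (\<Phi> x ** P' ** matrix_inv (\<Phi> x')) \<le> C' * exp (\<gamma> * (x - x'))"
    using bohl_lower_gtD[OF assms(1)] assms(2) by blast
  then have "norm (\<Phi> x ** (P + P') ** matrix_inv (\<Phi> x')) \<le> (C + C') * exp (\<gamma> * (x - x'))"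
    if "x \<in> I" "x' \<in> I" "x \<le> x'" for x x'
    unfolding matrix_mult.add_left matrix_mult.add_right distrib_right
    using that by (intro norm_triangle_mono) auto
  then show ?thesis by blast
qed

text \<open>
  On nonzero projections \<open>\<kappa>'\<^sub>+(P) \<le> \<lambda>\<^sub>+(P)\<close>, so the hypothesis on \<open>\<beta>\<close> forces both to be finite and \<open>\<beta> > 0\<close>.
\<close>

lemma jost_exponents_finite:
  assumes le: "l \<le> u" "u < (\<infinity>::ereal)" and \<beta>: "u - l < ereal \<beta>"
  obtains k m where "l = ereal k" "u = ereal m" "m - k < \<beta>" "0 \<le> \<beta>"
  using assms by (cases l; cases u) auto

theorem theorem6p5:
  fixes A R \<Phi> :: "real \<Rightarrow> complex^'d^'d"
    and Q Q1 Q2 :: "complex^'d^'d"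
    and \<beta> :: real
  assumes "L1_loc A"
    and "propagator A \<Phi>"
    and "exponentially_bounded \<Phi>"
    and "exponential_dichotomy \<Phi> Q"
    and "Q = Q1 + Q2"
    and "projection Q1" and "uniformly_conjugated \<Phi> Q1"
    and "projection Q2" and "uniformly_conjugated \<Phi> Q2"
    and "bohl_lower UNIV \<Phi> Q1 \<le> bohl_upper UNIV \<Phi> Q1"
    and "bohl_upper UNIV \<Phi> Q1 < bohl_lower UNIV \<Phi> Q2"
    and "bohl_lower UNIV \<Phi> Q2 \<le> bohl_upper UNIV \<Phi> Q2"
    and "bohl_upper UNIV \<Phi> Q2 < 0"
    and "0 < bohl_lower UNIV \<Phi> (mat 1 - Q)"
    and "bohl_lower UNIV \<Phi> (mat 1 - Q) \<le> bohl_upper UNIV \<Phi> (mat 1 - Q)"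
    and "L1_loc R"
    and "(\<lambda>x. exp (\<beta> * x) * norm (R x)) absolutely_integrable_on {0..}"
    and "ereal \<beta> > max (upper_lyapunov \<Phi> Q1 - bohl_lower {0..} \<Phi> Q1)
                        (upper_lyapunov \<Phi> Q2 - bohl_lower {0..} \<Phi> Q2)"
  shows "\<exists>Y1 Y2. generalized_jost_solution A R \<Phi> Q1 Y1 \<and> generalized_jost_solution A R \<Phi> Q2 Y2"
proof -
  note \<Phi> = propagator_half_line[OF assms(1,2,3,16,17)]
  note jost = generalized_jost_solution_exists[OF assms(1,2,3,16,17)]
  let ?l = "\<lambda>P. bohl_lower {0..} \<Phi> P" and ?m = "\<lambda>P. upper_lyapunov \<Phi> P"
  \<comment> \<open>Shrinking the line to the half-line can only raise lower and reduce upper Bohl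
    exponents, so the assumed ordering survives and can be compared with the half-line quantities in
    the condition on \<beta>.\<close>
  have restrict: "bohl_lower UNIV \<Phi> P \<le> ?l P" "?m P \<le> bohl_upper UNIV \<Phi> P" for P
    using bohl_lower_subset[of "{0..}" UNIV \<Phi> P] upper_lyapunov_le_bohl_upper[of \<Phi> P]
      bohl_upper_subset[of "{0..}" UNIV \<Phi> P] \<Phi>(1) by (auto intro: order_trans)
  have lm1: "?l Q1 \<le> ?m Q1" and lm2: "?l Q2 \<le> ?m Q2"
    using assms(6,8) \<Phi>(1,3) bohl_lower_le_bohl_upper_imp_nonzero[OF assms(10)]
      bohl_lower_le_bohl_upper_imp_nonzero[OF assms(12)]
    by (auto intro!: bohl_lower_le_upper_lyapunov)
  have l12: "?m Q1 < ?l Q2"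
    using restrict(2)[of Q1] assms(11) restrict(1)[of Q2] by order
  have m2: "?m Q2 < 0" using restrict(2)[of Q2] assms(13) by order
  have lQ: "0 < ?l (mat 1 - Q)" using assms(14) restrict(1)[of "mat 1 - Q"] by order
  have u1: "?l Q1 < ?l Q2" "?l Q2 < ?l (mat 1 - Q)" "?m Q1 < \<infinity>" "?m Q2 < \<infinity>"
    using lm1 lm2 l12 m2 lQ by (auto intro: le_less_trans less_trans)
  have \<beta>: "?m Q1 - ?l Q1 < ereal \<beta>" "?m Q2 - ?l Q2 < ereal \<beta>"
    using assms(18) by auto
  have "\<exists>Y. generalized_jost_solution A R \<Phi> Q1 Y"
  proof -
    obtain k m where km: "?l Q1 = ereal k" "?m Q1 = ereal m" "m - k < \<beta>" "0 \<le> \<beta>"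
      using lm1 u1(3) \<beta>(1) by (rule jost_exponents_finite)
    \<comment> \<open>The window is open by the condition on \<beta>. As \<gamma> is below the
      lowest of the three lower exponents, the whole identity can serve as
      \<open>P1\<close>.\<close>
    obtain \<gamma> where \<gamma>: "m - \<beta> < \<gamma>" "\<gamma> < k" using dense[of "m - \<beta>" k] km by auto
    have g: "ereal \<gamma> < ?l Q1" using \<gamma> km by simp
    then have g2: "ereal \<gamma> < ?l Q2" "ereal \<gamma> < ?l (mat 1 - Q)" using u1(1,2) by order+
    have "\<exists>C. \<forall>x\<in>{0..}. \<forall>s\<in>{0..}. x \<le> s \<longrightarrow>
        norm (\<Phi> x ** (Q1 + (Q2 + (mat 1 - Q))) ** matrix_inv (\<Phi> s)) \<le> C * exp (\<gamma> * (x - s))"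
      by (intro bohl_lower_bound_add bohl_lower_gtD g g2)
    moreover have "Q1 + (Q2 + (mat 1 - Q)) = mat 1" by (simp add: assms(5))
    ultimately show ?thesis
      using \<gamma> km g assms(6) by (intro jost[of 0 "mat 1"]) (auto intro!: exI[of _ 0])
  qed
  moreover have "\<exists>Y. generalized_jost_solution A R \<Phi> Q2 Y"
  proof -
    obtain k m where km: "?l Q2 = ereal k" "?m Q2 = ereal m" "m - k < \<beta>" "0 \<le> \<beta>"
      using lm2 u1(4) \<beta>(2) by (rule jost_exponents_finite)
    have up1: "bohl_upper {0..} \<Phi> Q1 < ?l Q2"
      using bohl_upper_subset[of "{0..}" UNIV \<Phi> Q1] assms(11) restrict(1)[of Q2] by auto
    \<comment> \<open>Here \<gamma> must also separate the blocks: it lies above the upper exponent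
      of \<open>Q1\<close>, which moves to the part integrated from \<open>a\<close> to
      \<open>x\<close>, and below the lower exponents of \<open>Q2\<close> and
      \<open>mat 1 - Q\<close>.\<close>
    have "max (bohl_upper {0..} \<Phi> Q1) (ereal (m - \<beta>)) < ?l Q2"
      using up1 km by simp
    then obtain \<gamma> where \<gamma>: "max (bohl_upper {0..} \<Phi> Q1) (ereal (m - \<beta>)) < ereal \<gamma>" "ereal \<gamma> < ?l Q2"
      using ereal_dense2 by blast
    have g2: "ereal \<gamma> < ?l (mat 1 - Q)" using \<gamma>(2) u1(2) by order
    have "\<exists>C. \<forall>x\<in>{0..}. \<forall>s\<in>{0..}. x \<le> s \<longrightarrow>
        norm (\<Phi> x ** (Q2 + (mat 1 - Q)) ** matrix_inv (\<Phi> s)) \<le> C * exp (\<gamma> * (x - s))"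
      by (intro bohl_lower_bound_add bohl_lower_gtD \<gamma>(2) g2)
    moreover have "\<exists>C. \<forall>x\<in>{0..}. \<forall>s\<in>{0..}. s \<le> x \<longrightarrow>
        norm (\<Phi> x ** Q1 ** matrix_inv (\<Phi> s)) \<le> C * exp (\<gamma> * (x - s))"
      using \<gamma>(1) by (intro bohl_upper_lessD) simp
    moreover have "Q1 + (Q2 + (mat 1 - Q)) = mat 1" by (simp add: assms(5))
    ultimately show ?thesis
      using \<gamma> km assms(8) by (intro jost[of Q1 "Q2 + (mat 1 - Q)"]) auto
  qed
  ultimately show ?thesis by blast
qed

end
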